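(* Using the closure formulas for the stresses and the definition of $\sigma_{\alpha+1/2}$ given in the context, the layer-averaging applied to the hydrostatic Navier-Stokes system completed with its boundary conditions (see context) leads to the system, for $\alpha=1,\dots,N$, $$\frac{\partial}{\partial t}\sum_{j=1}^Nh_j+\frac{\partial}{\partial x}\sum_{j=1}^Nh_ju_j=0,$$ $$\begin{aligned}\frac{\partial}{\partial t}(h_\alpha u_\alpha)+\frac{\partial}{\partial x}\Big(h_\alpha u_\alpha^2+\frac g2h_\alpha H\Big)=&-gh_\alpha\frac{\partial z_b}{\partial x}+u_{\alpha+1/2}G_{\alpha+1/2}-u_{\alpha-1/2}G_{\alpha-1/2}\\&+\frac{\partial}{\partial x}\Big(h_\alpha\Sigma_{xx,\alpha}-h_\alpha\Sigma_{zz,\alpha}+\frac{\partial}{\partial x}\big(h_\alpha z_\alpha\Sigma_{zx,\alpha}\big)\Big)\\&+z_{\alpha+1/2}\frac{\partial^2}{\partial x^2}\sum_{j=\alpha+1}^Nh_j\Sigma_{zx,j}-z_{\alpha-1/2}\frac{\partial^2}{\partial x^2}\sum_{j=\alpha}^Nh_j\Sigma_{zx,j}\\&+\sigma_{\alpha+1/2}-\sigma_{\alpha-1/2},\end{aligned}$$ $$w_\alpha=-\frac12\frac{\partial(h_\alpha u_\alpha)}{\partial x}-\sum_{j=1}^{\alpha-1}\frac{\partial(h_ju_j)}{\partial x}+u_\alpha\frac{\partial z_\alpha}{\partial x},$$ with the exchange terms $G_{\alpha\pm1/2}$ and the interface terms $\sigma_{\alpha\pm1/2}$ given in the context. For smooth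 solutions, one obtains the balance $$\begin{aligned}&\frac{\partial}{\partial t}\Big(\sum_{\alpha=1}^NE_\alpha\Big)+\frac{\partial}{\partial x}\Bigg(\sum_{\alpha=1}^Nu_\alpha\bigg(E_\alpha+\frac g2h_\alpha H-h_\alpha(\Sigma_{xx,\alpha}-\Sigma_{zz,\alpha})\\&\quad-\Big(\frac{\partial z_\alpha}{\partial x}h_\alpha\Sigma_{zx,\alpha}+h_\alpha\frac{\partial}{\partial x}\Big(\frac12h_\alpha\Sigma_{zx,\alpha}+\sum_{j=\alpha+1}^Nh_j\Sigma_{zx,j}\Big)\Big)\bigg)-\sum_{\alpha=1}^Nw_\alpha h_\alpha\Sigma_{zx,\alpha}\Bigg)\\&=-\sum_{\alpha=1}^N\bigg(\frac{\partial u_\alpha}{\partial x}h_\alpha(\Sigma_{xx,\alpha}-\Sigma_{zz,\alpha})+\Big(\frac{\partial w_\alpha}{\partial x}+\frac{\partial z_\alpha}{\partial x}\frac{\partial u_\alpha}{\partial x}\Big)h_\alpha\Sigma_{zx,\alpha}+\sigma_{\alpha+1/2}(u_{\alpha+1}-u_\alpha)\bigg)-\frac{\kappa}{c_b^3}u_1^2,\end{aligned}$$ with $E_\alpha=\frac{h_\alpha u_\alpha^2}{2}+\frac{g(z_{\alpha+1/2}^2-z_{\alpha-1/2}^2)}{2}=h_\alpha\big(\frac{u_\alpha^2}{2}+gz_\alpha\big)$, where in this balance the convention $u_0=u_1$, $u_{N+1}=u_N$ is used.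
   Context: Geometry. $x\in\mathbb R$ is horizontal, $z$ vertical, $g$ the gravity acceleration, $z_b(x)$ the bottom, $\eta(x,t)$ the free surface, $H=\eta-z_b$ the water depth. Fix $l_1,\dots,l_N>0$ with $\sum_jl_j=1$; $z_{\alpha+1/2}=z_b+\sum_{j=1}^\alpha l_jH$ ($\alpha=0,\dots,N$), $h_\alpha=z_{\alpha+1/2}-z_{\alpha-1/2}=l_\alpha H$, $z_\alpha=(z_{\alpha+1/2}+z_{\alpha-1/2})/2$. Put $c_{\alpha+1/2}=(1+(\partial_xz_{\alpha+1/2})^2)^{-1/2}$ and $c_b=c_{1/2}$. Hydrostatic Navier-Stokes system on $z_b\le z\le\eta$, with velocity $\mathbf u=(u,w)^T$ and an unspecified rheology $\Sigma=\begin{pmatrix}\Sigma_{xx}&\Sigma_{xz}\\\Sigma_{zx}&\Sigma_{zz}\end{pmatrix}$: $$\partial_xu+\partial_zw=0,$$ $$\partial_tu+\partial_x(u^2)+\partial_z(uw)+g\,\partial_x\eta=\partial_x\Sigma_{xx}+\partial_z\Sigma_{xz}+\partial_x^2\int_z^\eta\Sigma_{zx}\,dz_1-\partial_x\Sigma_{zz}.$$ It is obtained by eliminating the pressure $p$, using $\partial_zp=-g+\partial_x\Sigma_{zx}+\partial_z\Sigma_{zz}$ and the surface stress condition, from the momentum equation $\partial_tu+\partial_x(u^2)+\partial_z(uw)+\partial_xp=\partial_x\Sigma_{xx}+\partial_z\Sigma_{xz}$. Boundary conditions, with $\Sigma_T=-pI_d+\Sigma$ (subscripts $s$, $b$ denote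 values at the surface and the bottom): at $z=\eta$, $\partial_t\eta+u_s\partial_x\eta-w_s=0$ and $\Sigma_T\mathbf n_s=0$ (zero atmospheric pressure), with $\mathbf n_s$ the outward unit normal; at $z=z_b$, $u_b\partial_xz_b-w_b=0$ and the wall law $\Sigma_T\mathbf n_b-(\mathbf n_b\cdot\Sigma_T\mathbf n_b)\mathbf n_b=\kappa\mathbf u_b$, equivalently $\mathbf t_b\cdot\Sigma_T\mathbf n_b=\frac{\kappa}{c_b}u_b$, with $\mathbf n_b=c_b(-\partial_xz_b,1)^T$, $\mathbf t_b=c_b(1,\partial_xz_b)^T$ and friction coefficient $\kappa=\kappa(\mathbf u_b,H)\ge0$. Closure. $u$ and $w$ are replaced in layer $\alpha$ by constants-in-$z$ $u_\alpha(x,t)$, $w_\alpha(x,t)$ (so that $\int u^2dz$ and $\int zu\,dz$ over the layer become $h_\alpha u_\alpha^2$ and $h_\alpha z_\alpha u_\alpha$). For $(a,b)\in\{x,z\}^2$ the approximations $$\int_{z_{\alpha-1/2}}^{z_{\alpha+1/2}}\Sigma_{ab}\,dz\approx h_\alpha\Sigma_{ab,\alpha},\qquad\int_{z_{\alpha-1/2}}^{z_{\alpha+1/2}}z\Sigma_{ab}\,dz\approx\frac{z_{\alpha+1/2}^2-z_{\alpha-1/2}^2}{2}\Sigma_{ab,\alpha}=h_\alpha z_\alpha\Sigma_{ab,\alpha}$$ are used, $\Sigma_{ab,\alpha}$ and $\Sigma_{ab,\alpha+1/2}$ denoting approximations of $\Sigma_{ab}$ in layer $\alpha$ and at the interface $z_{\alpha+1/2}$.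 Exchange and interface terms. $G_{\alpha+1/2}=\partial_t\sum_{j=1}^\alpha h_j+\partial_x\sum_{j=1}^\alpha(h_ju_j)$, with $G_{1/2}=G_{N+1/2}=0$; the interface velocity is $u_{\alpha+1/2}=u_\alpha$ if $G_{\alpha+1/2}\le0$ and $u_{\alpha+1/2}=u_{\alpha+1}$ if $G_{\alpha+1/2}>0$. Further $$\sigma_{\alpha+1/2}=\Sigma_{xz,\alpha+1/2}-\frac{\partial z_{\alpha+1/2}}{\partial x}\Big(\Sigma_{xx,\alpha+1/2}+\frac{\partial z_{\alpha+1/2}}{\partial x}\Sigma_{zx,\alpha+1/2}-\Sigma_{zz,\alpha+1/2}\Big),$$ where $c_{\alpha+1/2}^2\sigma_{\alpha+1/2}$ is the tangential component of the stress at the interface; for $\alpha=0$ and $\alpha=N$ it is given by the boundary conditions, with $u_1$ used in place of $u_b$: $c_{1/2}^2\sigma_{1/2}=\frac{\kappa}{c_b}u_1$ and $c_{N+1/2}^2\sigma_{N+1/2}=0$.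
   Formalization: The printed energy balance fails for N≥2 with unequal layer velocities; its right side gains ∂_x Σ_α g h_α u_α(z_α+H/2−η) − Σ_{α=1}^{N−1} ½|G_{α+1/2}|(u_{α+1}−u_α)², the exact missing gravity-flux and upwind terms. *)

theory Defs
  imports "HOL-Analysis.Analysis"
begin

section \<open>Smooth functions and partial derivatives\<close>

primrec Ck_on :: "nat \<Rightarrow> 'a::real_normed_vector set \<Rightarrow> ('a \<Rightarrow> real) \<Rightarrow> bool" where
  "Ck_on 0 U f \<longleftrightarrow> continuous_on U f"
| "Ck_on (Suc k) U f \<longleftrightarrow> (\<forall>x\<in>U. f differentiable (at x)) \<and>
     (\<forall>v. Ck_on k U (\<lambda>x. frechet_derivative f (at x) v))"

text \<open>Smoothness on a set that need not be open (for instance up to the boundary of the fluid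
  domain) means that the function is of class \<open>C\<^sup>\<infinity>\<close> on an open neighbourhood of the set.\<close>

definition smooth_on :: "'a::real_normed_vector set \<Rightarrow> ('a \<Rightarrow> real) \<Rightarrow> bool" where
  "smooth_on A f \<longleftrightarrow> (\<exists>U. open U \<and> A \<subseteq> U \<and> (\<forall>k. Ck_on k U f))"

text \<open>Functions of \<open>(x, t)\<close> and of \<open>(x, z, t)\<close> are curried in this order.\<close>

definition dx :: "(real \<Rightarrow> real \<Rightarrow> real) \<Rightarrow> real \<Rightarrow> real \<Rightarrow> real" where
  "dx f x t = deriv (\<lambda>y. f y t) x"

definition dt :: "(real \<Rightarrow> real \<Rightarrow> real) \<Rightarrow> real \<Rightarrow> real \<Rightarrow> real" where
  "dt f x t = deriv (\<lambda>s. f x s) t"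

definition pdx :: "(real \<Rightarrow> real \<Rightarrow> real \<Rightarrow> real) \<Rightarrow> real \<Rightarrow> real \<Rightarrow> real \<Rightarrow> real" where
  "pdx f x z t = deriv (\<lambda>y. f y z t) x"

definition pdz :: "(real \<Rightarrow> real \<Rightarrow> real \<Rightarrow> real) \<Rightarrow> real \<Rightarrow> real \<Rightarrow> real \<Rightarrow> real" where
  "pdz f x z t = deriv (\<lambda>r. f x r t) z"

definition pdt :: "(real \<Rightarrow> real \<Rightarrow> real \<Rightarrow> real) \<Rightarrow> real \<Rightarrow> real \<Rightarrow> real \<Rightarrow> real" where
  "pdt f x z t = deriv (\<lambda>s. f x z s) t"

datatype axis = X | Z

section \<open>The hydrostatic Navier-Stokes system\<close>

definition fluid_domain ::
    "(real \<Rightarrow> real) \<Rightarrow> (real \<Rightarrow> real \<Rightarrow> real) \<Rightarrow> real set \<Rightarrow> (real \<times> real \<times> real) set" where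
  "fluid_domain zb H I = {(x, z, t). t \<in> I \<and> zb x \<le> z \<and> z \<le> zb x + H x t}"

text \<open>The stress vector \<open>\<Sigma>\<^sub>T n\<close> with \<open>\<Sigma>\<^sub>T = - p Id + \<Sigma>\<close>.\<close>

definition traction ::
    "(real \<Rightarrow> real \<Rightarrow> real \<Rightarrow> real) \<Rightarrow> (axis \<Rightarrow> axis \<Rightarrow> real \<Rightarrow> real \<Rightarrow> real \<Rightarrow> real) \<Rightarrow>
      real \<Rightarrow> real \<Rightarrow> real \<Rightarrow> real \<times> real \<Rightarrow> real \<times> real" where
  "traction p S x z t n =
     ((S X X x z t - p x z t) * fst n + S X Z x z t * snd n,
      S Z X x z t * fst n + (S Z Z x z t - p x z t) * snd n)"

text \<open>The unit normal to a curve of slope \<open>s\<close>, pointing upwards (also at the bottom, where it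
  points into the fluid).\<close>

definition upward_normal :: "real \<Rightarrow> real \<times> real" where
  "upward_normal s = (1 / sqrt (1 + s\<^sup>2)) *\<^sub>R (- s, 1)"

text \<open>A smooth solution \<open>(H, u, w, p)\<close>, with stresses \<open>S\<close>, of the hydrostatic Navier-Stokes system
  and its boundary conditions, on the time set \<open>I\<close>.  The equations are only required in
  the interior of the fluid domain, where \<open>{z..\<eta>}\<close> is a proper interval for
  all abscissas close to \<open>x\<close>; they extend to the boundary by continuity.\<close>

definition hydrostatic_NS where
  "hydrostatic_NS (g :: real) (zb :: real \<Rightarrow> real) (kappa :: real \<times> real \<Rightarrow> real \<Rightarrow> real)
      (I :: real set) (H :: real \<Rightarrow> real \<Rightarrow> real) (u :: real \<Rightarrow> real \<Rightarrow> real \<Rightarrow> real)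
      (w :: real \<Rightarrow> real \<Rightarrow> real \<Rightarrow> real) (p :: real \<Rightarrow> real \<Rightarrow> real \<Rightarrow> real)
      (S :: axis \<Rightarrow> axis \<Rightarrow> real \<Rightarrow> real \<Rightarrow> real \<Rightarrow> real) \<longleftrightarrow>
   (let \<eta> = (\<lambda>x t. zb x + H x t);
        D = fluid_domain zb H I
    in smooth_on D (\<lambda>(x, z, t). u x z t) \<and>
       smooth_on D (\<lambda>(x, z, t). w x z t) \<and>
       smooth_on D (\<lambda>(x, z, t). p x z t) \<and>
       (\<forall>a b. smooth_on D (\<lambda>(x, z, t). S a b x z t)) \<and>
       (\<forall>x z t. t \<in> I \<and> zb x < z \<and> z < \<eta> x t \<longrightarrow>
          pdx u x z t + pdz w x z t = 0 \<and>
          pdt u x z t + pdx (\<lambda>x z t. (u x z t)\<^sup>2) x z t + pdz (\<lambda>x z t. u x z t * w x z t) x z t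
              + g * dx \<eta> x t
            = pdx (S X X) x z t + pdz (S X Z) x z t
              + pdx (pdx (\<lambda>x z t. integral {z..\<eta> x t} (\<lambda>r. S Z X x r t))) x z t
              - pdx (S Z Z) x z t \<and>
          pdz p x z t = - g + pdx (S Z X) x z t + pdz (S Z Z) x z t) \<and>
       (\<forall>x. \<forall>t\<in>I.
          (let us = u x (\<eta> x t) t; ws = w x (\<eta> x t) t
           in dt \<eta> x t + us * dx \<eta> x t - ws = 0) \<and>
          traction p S x (\<eta> x t) t (upward_normal (dx \<eta> x t)) = 0 \<and>
          (let ub = u x (zb x) t; wb = w x (zb x) t; nb = upward_normal (deriv zb x);
               F = traction p S x (zb x) t nb
           in ub * deriv zb x - wb = 0 \<and>
              F - (nb \<bullet> F) *\<^sub>R nb = kappa (ub, wb) (H x t) *\<^sub>R (ub, wb))))"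

section \<open>Layer averages\<close>

text \<open>The quantities that remain after the equations have been integrated over the layers.  Layers
  are numbered from 1 to \<open>N\<close>; the interface at \<open>\<alpha> + 1/2\<close> has number \<open>\<alpha>\<close>, from 0 (bottom) to
  \<open>N\<close> (surface).\<close>

record averages =
  int_u  :: "nat \<Rightarrow> real \<Rightarrow> real \<Rightarrow> real"   \<comment> \<open>\<open>\<integral> u dz\<close> over a layer\<close>
  int_uu :: "nat \<Rightarrow> real \<Rightarrow> real \<Rightarrow> real"   \<comment> \<open>\<open>\<integral> u\<^sup>2 dz\<close>\<close>
  int_zu :: "nat \<Rightarrow> real \<Rightarrow> real \<Rightarrow> real"   \<comment> \<open>\<open>\<integral> z u dz\<close>\<close>
  int_w  :: "nat \<Rightarrow> real \<Rightarrow> real \<Rightarrow> real"   \<comment> \<open>\<open>\<integral> w dz\<close>\<close>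
  int_S  :: "axis \<Rightarrow> axis \<Rightarrow> nat \<Rightarrow> real \<Rightarrow> real \<Rightarrow> real"   \<comment> \<open>\<open>\<integral> \<Sigma>\<^sub>a\<^sub>b dz\<close>\<close>
  int_zS :: "axis \<Rightarrow> axis \<Rightarrow> nat \<Rightarrow> real \<Rightarrow> real \<Rightarrow> real"   \<comment> \<open>\<open>\<integral> z \<Sigma>\<^sub>a\<^sub>b dz\<close>\<close>
  face_u :: "nat \<Rightarrow> real \<Rightarrow> real \<Rightarrow> real"   \<comment> \<open>\<open>u\<close> at an interface\<close>
  face_sigma :: "nat \<Rightarrow> real \<Rightarrow> real \<Rightarrow> real"   \<comment> \<open>\<open>\<sigma>\<close> at an interface\<close>
  bed_velocity :: "real \<Rightarrow> real \<Rightarrow> real \<times> real"   \<comment> \<open>\<open>(u\<^sub>b, w\<^sub>b)\<close>\<close>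

context
  fixes N :: nat and l :: "nat \<Rightarrow> real" and g :: real and zb :: "real \<Rightarrow> real"
    and kappa :: "real \<times> real \<Rightarrow> real \<Rightarrow> real" and H :: "real \<Rightarrow> real \<Rightarrow> real"
begin

definition layer_h :: "nat \<Rightarrow> real \<Rightarrow> real \<Rightarrow> real" where
  "layer_h \<alpha> x t = l \<alpha> * H x t"

definition z_face :: "nat \<Rightarrow> real \<Rightarrow> real \<Rightarrow> real" where
  "z_face \<alpha> x t = zb x + (\<Sum>j=1..\<alpha>. l j * H x t)"

definition z_mid :: "nat \<Rightarrow> real \<Rightarrow> real \<Rightarrow> real" where
  "z_mid \<alpha> x t = (z_face \<alpha> x t + z_face (\<alpha> - 1) x t) / 2"

definition c_face :: "nat \<Rightarrow> real \<Rightarrow> real \<Rightarrow> real" where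
  "c_face \<alpha> x t = 1 / sqrt (1 + (dx (z_face \<alpha>) x t)\<^sup>2)"

text \<open>\<open>\<sigma>\<close> at an interface, as a function of the stresses \<open>s\<close> there.\<close>

definition sigma_of :: "nat \<Rightarrow> (axis \<Rightarrow> axis \<Rightarrow> real) \<Rightarrow> real \<Rightarrow> real \<Rightarrow> real" where
  "sigma_of \<alpha> s x t =
     s X Z - dx (z_face \<alpha>) x t * (s X X + dx (z_face \<alpha>) x t * s Z X - s Z Z)"

text \<open>The exchange term at an interface, for layer discharges \<open>q\<close> (equal to \<open>h\<^sub>j u\<^sub>j\<close> after
  closure).\<close>

definition exchange :: "(nat \<Rightarrow> real \<Rightarrow> real \<Rightarrow> real) \<Rightarrow> nat \<Rightarrow> real \<Rightarrow> real \<Rightarrow> real" where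
  "exchange q \<alpha> x t =
     (if \<alpha> = 0 \<or> \<alpha> = N then 0
      else dt (\<lambda>x t. \<Sum>j=1..\<alpha>. layer_h j x t) x t + dx (\<lambda>x t. \<Sum>j=1..\<alpha>. q j x t) x t)"

text \<open>The equations obtained by integrating over each layer the incompressibility equation (summed
  over the layers), the horizontal momentum equation, and \<open>z\<close> times the incompressibility
  equation, moving derivatives outside the integrals and using the kinematic boundary conditions,
  together with the stress boundary conditions expressed through \<open>\<sigma>\<close>.  No closure is involved.\<close>

definition averaged_equations :: "real set \<Rightarrow> averages \<Rightarrow> bool" where
  "averaged_equations I A \<longleftrightarrow> (\<forall>x. \<forall>t\<in>I.
     dt (\<lambda>x t. \<Sum>j=1..N. layer_h j x t) x t + dx (\<lambda>x t. \<Sum>j=1..N. int_u A j x t) x t = 0 \<and>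
     (\<forall>\<alpha>\<in>{1..N}.
        dt (int_u A \<alpha>) x t + dx (int_uu A \<alpha>) x t + g * layer_h \<alpha> x t * dx (\<lambda>x t. zb x + H x t) x t
          = face_u A \<alpha> x t * exchange (int_u A) \<alpha> x t
            - face_u A (\<alpha> - 1) x t * exchange (int_u A) (\<alpha> - 1) x t
            + dx (\<lambda>x t. int_S A X X \<alpha> x t - int_S A Z Z \<alpha> x t + dx (int_zS A Z X \<alpha>) x t) x t
            + z_face \<alpha> x t * dx (dx (\<lambda>x t. \<Sum>j=\<alpha>+1..N. int_S A Z X j x t)) x t
            - z_face (\<alpha> - 1) x t * dx (dx (\<lambda>x t. \<Sum>j=\<alpha>..N. int_S A Z X j x t)) x t
            + face_sigma A \<alpha> x t - face_sigma A (\<alpha> - 1) x t) \<and>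
     (\<forall>\<alpha>\<in>{1..N}.
        int_w A \<alpha> x t = dx (int_zu A \<alpha>) x t
          - z_face \<alpha> x t * dx (\<lambda>x t. \<Sum>j=1..\<alpha>. int_u A j x t) x t
          + z_face (\<alpha> - 1) x t * dx (\<lambda>x t. \<Sum>j=1..\<alpha>-1. int_u A j x t) x t) \<and>
     (c_face 0 x t)\<^sup>2 * face_sigma A 0 x t
       = kappa (bed_velocity A x t) (H x t) / c_face 0 x t * fst (bed_velocity A x t) \<and>
     (c_face N x t)\<^sup>2 * face_sigma A N x t = 0)"

text \<open>Averages of functions of \<open>(x, z, t)\<close>.\<close>

definition layer_int :: "(real \<Rightarrow> real \<Rightarrow> real \<Rightarrow> real) \<Rightarrow> nat \<Rightarrow> real \<Rightarrow> real \<Rightarrow> real" where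
  "layer_int f \<alpha> x t = integral {z_face (\<alpha> - 1) x t..z_face \<alpha> x t} (\<lambda>z. f x z t)"

definition exact_averages ::
    "(real \<Rightarrow> real \<Rightarrow> real \<Rightarrow> real) \<Rightarrow> (real \<Rightarrow> real \<Rightarrow> real \<Rightarrow> real) \<Rightarrow>
      (axis \<Rightarrow> axis \<Rightarrow> real \<Rightarrow> real \<Rightarrow> real \<Rightarrow> real) \<Rightarrow> averages" where
  "exact_averages u w S = \<lparr>
     int_u = layer_int u,
     int_uu = layer_int (\<lambda>x z t. (u x z t)\<^sup>2),
     int_zu = layer_int (\<lambda>x z t. z * u x z t),
     int_w = layer_int w,
     int_S = (\<lambda>a b. layer_int (S a b)),
     int_zS = (\<lambda>a b. layer_int (\<lambda>x z t. z * S a b x z t)),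
     face_u = (\<lambda>\<alpha> x t. u x (z_face \<alpha> x t) t),
     face_sigma = (\<lambda>\<alpha> x t. sigma_of \<alpha> (\<lambda>a b. S a b x (z_face \<alpha> x t) t) x t),
     bed_velocity = (\<lambda>x t. (u x (zb x) t, w x (zb x) t)) \<rparr>"

section \<open>The closure and the layer-averaged system\<close>

definition ext_u :: "(nat \<Rightarrow> real \<Rightarrow> real \<Rightarrow> real) \<Rightarrow> nat \<Rightarrow> real \<Rightarrow> real \<Rightarrow> real" where
  "ext_u u \<alpha> = (if \<alpha> = 0 then u 1 else if N < \<alpha> then u N else u \<alpha>)"

abbreviation discharge :: "(nat \<Rightarrow> real \<Rightarrow> real \<Rightarrow> real) \<Rightarrow> nat \<Rightarrow> real \<Rightarrow> real \<Rightarrow> real" where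
  "discharge u \<equiv> (\<lambda>j x t. layer_h j x t * u j x t)"

definition upwind_u :: "(nat \<Rightarrow> real \<Rightarrow> real \<Rightarrow> real) \<Rightarrow> nat \<Rightarrow> real \<Rightarrow> real \<Rightarrow> real" where
  "upwind_u u \<alpha> x t =
     (if exchange (discharge u) \<alpha> x t \<le> 0 then ext_u u \<alpha> x t else ext_u u (\<alpha> + 1) x t)"

text \<open>The friction coefficient of the layer-averaged model: \<open>u\<^sub>b\<close> is replaced by \<open>u\<^sub>1\<close>, so that
  impermeability of the bottom makes the second velocity component \<open>u\<^sub>1 \<partial>\<^sub>x z\<^sub>b\<close>.\<close>

definition closed_bed_velocity :: "(nat \<Rightarrow> real \<Rightarrow> real \<Rightarrow> real) \<Rightarrow> real \<Rightarrow> real \<Rightarrow> real \<times> real" where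
  "closed_bed_velocity u x t = (u 1 x t, u 1 x t * deriv zb x)"

definition closed_kappa :: "(nat \<Rightarrow> real \<Rightarrow> real \<Rightarrow> real) \<Rightarrow> real \<Rightarrow> real \<Rightarrow> real" where
  "closed_kappa u x t = kappa (closed_bed_velocity u x t) (H x t)"

text \<open>\<open>Sf a b \<alpha>\<close> approximates \<open>\<Sigma>\<^sub>a\<^sub>b\<close> at the interface \<open>\<alpha>\<close>; it enters only at the
  interior interfaces, the bottom and the surface being governed by the boundary conditions.\<close>

definition closed_sigma ::
    "(nat \<Rightarrow> real \<Rightarrow> real \<Rightarrow> real) \<Rightarrow> (axis \<Rightarrow> axis \<Rightarrow> nat \<Rightarrow> real \<Rightarrow> real \<Rightarrow> real) \<Rightarrow>
      nat \<Rightarrow> real \<Rightarrow> real \<Rightarrow> real" where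
  "closed_sigma u Sf \<alpha> x t =
     (if \<alpha> = 0 then (closed_kappa u x t / c_face 0 x t * u 1 x t) / (c_face 0 x t)\<^sup>2
      else if \<alpha> = N then 0
      else sigma_of \<alpha> (\<lambda>a b. Sf a b \<alpha> x t) x t)"

text \<open>\<open>Sl a b \<alpha>\<close> approximates \<open>\<Sigma>\<^sub>a\<^sub>b\<close> in the layer \<open>\<alpha>\<close>.\<close>

definition closed_averages ::
    "(nat \<Rightarrow> real \<Rightarrow> real \<Rightarrow> real) \<Rightarrow> (nat \<Rightarrow> real \<Rightarrow> real \<Rightarrow> real) \<Rightarrow>
      (axis \<Rightarrow> axis \<Rightarrow> nat \<Rightarrow> real \<Rightarrow> real \<Rightarrow> real) \<Rightarrow>
      (axis \<Rightarrow> axis \<Rightarrow> nat \<Rightarrow> real \<Rightarrow> real \<Rightarrow> real) \<Rightarrow> averages" where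
  "closed_averages u w Sl Sf = \<lparr>
     int_u = discharge u,
     int_uu = (\<lambda>\<alpha> x t. layer_h \<alpha> x t * (u \<alpha> x t)\<^sup>2),
     int_zu = (\<lambda>\<alpha> x t. layer_h \<alpha> x t * z_mid \<alpha> x t * u \<alpha> x t),
     int_w = (\<lambda>\<alpha> x t. layer_h \<alpha> x t * w \<alpha> x t),
     int_S = (\<lambda>a b \<alpha> x t. layer_h \<alpha> x t * Sl a b \<alpha> x t),
     int_zS = (\<lambda>a b \<alpha> x t.
       ((z_face \<alpha> x t)\<^sup>2 - (z_face (\<alpha> - 1) x t)\<^sup>2) / 2 * Sl a b \<alpha> x t),
     face_u = upwind_u u,
     face_sigma = closed_sigma u Sf,
     bed_velocity = closed_bed_velocity u \<rparr>"

definition layer_averaged_system ::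
    "real set \<Rightarrow> (nat \<Rightarrow> real \<Rightarrow> real \<Rightarrow> real) \<Rightarrow> (nat \<Rightarrow> real \<Rightarrow> real \<Rightarrow> real) \<Rightarrow>
      (axis \<Rightarrow> axis \<Rightarrow> nat \<Rightarrow> real \<Rightarrow> real \<Rightarrow> real) \<Rightarrow>
      (axis \<Rightarrow> axis \<Rightarrow> nat \<Rightarrow> real \<Rightarrow> real \<Rightarrow> real) \<Rightarrow> bool" where
  "layer_averaged_system I u w Sl Sf \<longleftrightarrow> (\<forall>x. \<forall>t\<in>I.
     dt (\<lambda>x t. \<Sum>j=1..N. layer_h j x t) x t
       + dx (\<lambda>x t. \<Sum>j=1..N. layer_h j x t * u j x t) x t = 0 \<and>
     (\<forall>\<alpha>\<in>{1..N}.
        dt (\<lambda>x t. layer_h \<alpha> x t * u \<alpha> x t) x t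
          + dx (\<lambda>x t. layer_h \<alpha> x t * (u \<alpha> x t)\<^sup>2 + g / 2 * layer_h \<alpha> x t * H x t) x t
        = - g * layer_h \<alpha> x t * deriv zb x
          + upwind_u u \<alpha> x t * exchange (discharge u) \<alpha> x t
          - upwind_u u (\<alpha> - 1) x t * exchange (discharge u) (\<alpha> - 1) x t
          + dx (\<lambda>x t. layer_h \<alpha> x t * Sl X X \<alpha> x t - layer_h \<alpha> x t * Sl Z Z \<alpha> x t
                 + dx (\<lambda>x t. layer_h \<alpha> x t * z_mid \<alpha> x t * Sl Z X \<alpha> x t) x t) x t
          + z_face \<alpha> x t * dx (dx (\<lambda>x t. \<Sum>j=\<alpha>+1..N. layer_h j x t * Sl Z X j x t)) x t
          - z_face (\<alpha> - 1) x t * dx (dx (\<lambda>x t. \<Sum>j=\<alpha>..N. layer_h j x t * Sl Z X j x t)) x t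
          + closed_sigma u Sf \<alpha> x t - closed_sigma u Sf (\<alpha> - 1) x t) \<and>
     (\<forall>\<alpha>\<in>{1..N}.
        w \<alpha> x t = - (1 / 2) * dx (\<lambda>x t. layer_h \<alpha> x t * u \<alpha> x t) x t
          - (\<Sum>j=1..\<alpha>-1. dx (\<lambda>x t. layer_h j x t * u j x t) x t)
          + u \<alpha> x t * dx (z_mid \<alpha>) x t))"

section \<open>The energy balance\<close>

definition energy :: "(nat \<Rightarrow> real \<Rightarrow> real \<Rightarrow> real) \<Rightarrow> nat \<Rightarrow> real \<Rightarrow> real \<Rightarrow> real" where
  "energy u \<alpha> x t = layer_h \<alpha> x t * (u \<alpha> x t)\<^sup>2 / 2
     + g * ((z_face \<alpha> x t)\<^sup>2 - (z_face (\<alpha> - 1) x t)\<^sup>2) / 2"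

definition energy_flux ::
    "(nat \<Rightarrow> real \<Rightarrow> real \<Rightarrow> real) \<Rightarrow> (nat \<Rightarrow> real \<Rightarrow> real \<Rightarrow> real) \<Rightarrow>
      (axis \<Rightarrow> axis \<Rightarrow> nat \<Rightarrow> real \<Rightarrow> real \<Rightarrow> real) \<Rightarrow> real \<Rightarrow> real \<Rightarrow> real" where
  "energy_flux u w Sl x t =
     (\<Sum>\<alpha>=1..N. u \<alpha> x t *
        (energy u \<alpha> x t + g / 2 * layer_h \<alpha> x t * H x t
         - layer_h \<alpha> x t * (Sl X X \<alpha> x t - Sl Z Z \<alpha> x t)
         - (dx (z_mid \<alpha>) x t * layer_h \<alpha> x t * Sl Z X \<alpha> x t
            + layer_h \<alpha> x t *
              dx (\<lambda>x t. 1 / 2 * layer_h \<alpha> x t * Sl Z X \<alpha> x t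
                    + (\<Sum>j=\<alpha>+1..N. layer_h j x t * Sl Z X j x t)) x t)))
     - (\<Sum>\<alpha>=1..N. w \<alpha> x t * layer_h \<alpha> x t * Sl Z X \<alpha> x t)"

definition energy_source ::
    "(nat \<Rightarrow> real \<Rightarrow> real \<Rightarrow> real) \<Rightarrow> (nat \<Rightarrow> real \<Rightarrow> real \<Rightarrow> real) \<Rightarrow>
      (axis \<Rightarrow> axis \<Rightarrow> nat \<Rightarrow> real \<Rightarrow> real \<Rightarrow> real) \<Rightarrow>
      (axis \<Rightarrow> axis \<Rightarrow> nat \<Rightarrow> real \<Rightarrow> real \<Rightarrow> real) \<Rightarrow> real \<Rightarrow> real \<Rightarrow> real" where
  "energy_source u w Sl Sf x t =
     - (\<Sum>\<alpha>=1..N.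
          dx (u \<alpha>) x t * layer_h \<alpha> x t * (Sl X X \<alpha> x t - Sl Z Z \<alpha> x t)
          + (dx (w \<alpha>) x t + dx (z_mid \<alpha>) x t * dx (u \<alpha>) x t) * layer_h \<alpha> x t * Sl Z X \<alpha> x t
          + closed_sigma u Sf \<alpha> x t * (ext_u u (\<alpha> + 1) x t - ext_u u \<alpha> x t))
     - closed_kappa u x t / (c_face 0 x t) ^ 3 * (u 1 x t)\<^sup>2"

text \<open>The identity with flux \<open>energy_flux\<close> and right-hand side \<open>energy_source\<close> alone omits two
  quantities, which vanish when all layer velocities agree but not in general.  First, the
  work of gravity is in flux form with \<open>g h\<^sub>\<alpha> \<eta>\<close>, and \<open>E\<^sub>\<alpha> + g h\<^sub>\<alpha> H / 2\<close>
  contains \<open>g h\<^sub>\<alpha> (z\<^sub>\<alpha> + H / 2)\<close> instead.  Second, the upwind interface velocity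
  dissipates energy at each interior interface.  For example, with \<open>N = 2\<close>, \<open>l\<^sub>1 = l\<^sub>2 = 1/2\<close>,
  \<open>z\<^sub>b = 0\<close>, \<open>H = 1\<close>, \<open>\<kappa> = 0\<close>, \<open>u\<^sub>1 = x\<close>, \<open>u\<^sub>2 = - x\<close>, \<open>\<Sigma>\<^sub>x\<^sub>x\<close> equal to \<open>3 x\<^sup>2 / 2\<close> and \<open>x\<^sup>2 / 2\<close>
  in the two layers and all other stresses zero, the two sides without this term
  are \<open>- 3 x\<^sup>2 / 2 - g / 4\<close> and \<open>- x\<^sup>2 / 2\<close>.\<close>

definition energy_correction ::
    "(nat \<Rightarrow> real \<Rightarrow> real \<Rightarrow> real) \<Rightarrow> real \<Rightarrow> real \<Rightarrow> real" where
  "energy_correction u x t =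
     dx (\<lambda>x t. \<Sum>\<alpha>=1..N. g * layer_h \<alpha> x t * u \<alpha> x t *
            (z_mid \<alpha> x t + H x t / 2 - (zb x + H x t))) x t
     - (\<Sum>\<alpha>=1..N-1. \<bar>exchange (discharge u) \<alpha> x t\<bar> / 2 * (u (\<alpha> + 1) x t - u \<alpha> x t)\<^sup>2)"

end

end

theory Submission
  imports Defs
begin

text \<open>Every averaged equation is the integral of a local one over a layer, with derivatives pulled out
  by the Leibniz rule for moving limits; the boundary terms are recognised as exchange and
  \<open>\<sigma>\<close> terms by means of the continuity equation integrated from the bottom. The only delicate
  term is \<open>\<partial>\<^sub>x\<^sup>2 \<integral>\<^sub>z\<^sup>\<eta> \<Sigma>\<^sub>z\<^sub>x\<close>, which is integrated by parts in \<open>z\<close>. For the energy balance, the momentum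
  equation of each layer is multiplied by its velocity, and the remainders cancel in the sum over the
  layers: gravity and \<open>\<sigma>\<close> terms by summation by parts, the coupling of each layer with the stresses
  above and the discharges below by exchanging a triangular double sum, while the upwind choice turns the
  exchange terms into \<open>- |G| (u\<^sub>\<alpha>\<^sub>+\<^sub>1 - u\<^sub>\<alpha>)\<^sup>2 / 2\<close>.\<close>

section \<open>The Leibniz rule with moving limits\<close>

text \<open>The local equations hold only strictly between bottom and surface, while the layers are
  closed intervals. Integrands are therefore exchanged only in the interior of a layer, whose two
  end points are negligible. The fields, on the other hand, are smooth in a neighbourhood of the
  closed fluid domain, so their traces on every interface, bottom and surface included, can be
  differentiated by the ordinary chain rule.

  The pressure never enters the averaged equations: it occurs in the stress conditions at the bottom
  and the surface, and one linear combination of the two components of each condition removes it.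
  That combination is the tangential one, which is where the formula for \<open>\<sigma>\<close>
  comes from. At interior interfaces the same formula arises from the Leibniz traces of the stresses
  together with the slope-squared surplus of the non-local term.

  In the energy balance no regularity of the vertical velocities is assumed; their differentiability
  in x comes from the closed formula that the system prescribes for them.\<close>

definition partials_on ::
    "(real \<times> real) set \<Rightarrow> (real \<Rightarrow> real \<Rightarrow> real) \<Rightarrow> (real \<Rightarrow> real \<Rightarrow> real) \<Rightarrow> (real \<Rightarrow> real \<Rightarrow> real) \<Rightarrow> bool" where
  "partials_on W f fy fz \<longleftrightarrow>
     (\<forall>(y, z)\<in>W. ((\<lambda>(y, z). f y z) has_derivative (\<lambda>(h, k). h * fy y z + k * fz y z)) (at (y, z))) \<and>
     continuous_on W (\<lambda>(y, z). fy y z) \<and> continuous_on W (\<lambda>(y, z). fz y z)"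

text \<open>A joint derivative, not merely two partial ones, is what permits differentiation along
  curves. The slots of \<open>partials_on\<close> stand for (x, z) at a frozen time or for (t, z) at
  a frozen abscissa, so that a single Leibniz rule covers both cases.\<close>

lemma partials_on_chain:
  assumes "partials_on W f fy fz" "(a s, b s) \<in> W"
    and "(a has_real_derivative a') (at s within T)" "(b has_real_derivative b') (at s within T)"
  shows "((\<lambda>s. f (a s) (b s)) has_real_derivative a' * fy (a s) (b s) + b' * fz (a s) (b s)) (at s within T)"
proof -
  have "((\<lambda>s. (a s, b s)) has_derivative (\<lambda>h. (h * a', h * b'))) (at s within T)"
    using assms(3,4) unfolding has_field_derivative_def
    by (auto intro!: has_derivative_Pair simp: mult.commute[of _ a'] mult.commute[of _ b'])
  moreover have "((\<lambda>(y, z). f y z) has_derivative (\<lambda>(h, k). h * fy (a s) (b s) + k * fz (a s) (b s))) (at (a s, b s))"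
    using assms(1,2) unfolding partials_on_def by blast
  ultimately have "((\<lambda>s. (\<lambda>(y, z). f y z) (a s, b s)) has_derivative
      (\<lambda>h. (\<lambda>(h, k). h * fy (a s) (b s) + k * fz (a s) (b s)) (h * a', h * b'))) (at s within T)"
    using has_derivative_compose[of "\<lambda>s. (a s, b s)"] by blast
  thus ?thesis
    unfolding has_field_derivative_def prod.case
    by (rule has_derivative_eq_rhs) (auto simp: algebra_simps)
qed

lemma partials_on_fst:
  assumes "partials_on W f fy fz" "(y, z) \<in> W"
  shows "((\<lambda>y. f y z) has_real_derivative fy y z) (at y)"
  using partials_on_chain[OF assms(1), of "\<lambda>y. y" y "\<lambda>_. z" 1 UNIV 0] assms(2) by simp

lemma partials_on_snd:
  assumes "partials_on W f fy fz" "(y, z) \<in> W"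
  shows "((\<lambda>z. f y z) has_real_derivative fz y z) (at z)"
  using partials_on_chain[OF assms(1), of "\<lambda>_. y" z "\<lambda>z. z" 0 UNIV 1] assms(2) by simp

lemma partials_on_continuous:
  assumes "partials_on W f fy fz"
  shows "continuous_on W (\<lambda>(y, z). f y z)"
proof -
  have "continuous (at p) (\<lambda>(y, z). f y z)" if "p \<in> W" for p
    using assms that unfolding partials_on_def by (cases p) (auto intro: has_derivative_continuous)
  thus ?thesis by (simp add: continuous_at_imp_continuous_on)
qed

lemma continuous_on_curve:
  assumes "continuous_on W (\<lambda>(y, z). f y z)" "continuous_on T a" "continuous_on T b"
    "\<And>s. s \<in> T \<Longrightarrow> (a s, b s) \<in> W"
  shows "continuous_on T (\<lambda>s. f (a s) (b s) :: real)"
proof -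
  have "continuous_on T (\<lambda>s. (\<lambda>(y, z). f y z) (a s, b s))"
    by (rule continuous_on_compose2[OF assms(1)]) (use assms in \<open>auto intro!: continuous_intros\<close>)
  thus ?thesis by simp
qed

lemma partials_on_mult:
  assumes f: "partials_on W f fy fz" and g: "partials_on W g gy gz"
  shows "partials_on W (\<lambda>y z. f y z * g y z)
    (\<lambda>y z. fy y z * g y z + f y z * gy y z) (\<lambda>y z. fz y z * g y z + f y z * gz y z)"
proof -
  note cont = partials_on_continuous[OF f] partials_on_continuous[OF g]
  have "((\<lambda>(y, z). f y z * g y z) has_derivative (\<lambda>(h, k). h * (fy y z * g y z + f y z * gy y z)
      + k * (fz y z * g y z + f y z * gz y z))) (at (y, z))" if "(y, z) \<in> W" for y z
  proof -
    have "((\<lambda>p. (\<lambda>(y, z). f y z) p * (\<lambda>(y, z). g y z) p) has_derivative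
        (\<lambda>v. (\<lambda>(y, z). f y z) (y, z) * (\<lambda>(h, k). h * gy y z + k * gz y z) v
           + (\<lambda>(h, k). h * fy y z + k * fz y z) v * (\<lambda>(y, z). g y z) (y, z))) (at (y, z))"
      by (rule has_derivative_mult) (use f g that in \<open>auto simp: partials_on_def\<close>)
    thus ?thesis
      by (auto simp: case_prod_unfold algebra_simps elim!: has_derivative_eq_rhs)
  qed
  thus ?thesis
    using f g cont unfolding partials_on_def
    by (auto simp: case_prod_unfold intro!: continuous_intros)
qed

lemma partials_on_proj_snd: "partials_on W (\<lambda>y z. z) (\<lambda>y z. 0) (\<lambda>y z. 1)"
  unfolding partials_on_def
  using has_derivative_snd[OF has_derivative_ident] by (auto simp: case_prod_unfold)

lemma integral_unit_substitution:
  fixes f :: "real \<Rightarrow> real"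
  assumes "a \<le> b" "continuous_on {a..b} f"
  shows "integral {0..1} (\<lambda>s. (b - a) * f (a + s * (b - a))) = integral {a..b} f"
proof -
  have "a + x * (b - a) \<le> b" if "x \<in> {0..1}" for x
    using that assms(1) mult_left_le_one_le[of "b - a" x] by auto
  hence "((\<lambda>s. (b - a) *\<^sub>R f (a + s * (b - a))) has_integral
      integral {a + 0 * (b - a)..a + 1 * (b - a)} f) {0..1}"
    using assms by (intro has_integral_substitution[where c = a and d = b]) (auto intro!: derivative_eq_intros)
  thus ?thesis by (auto dest: integral_unique)
qed

text \<open>The substitution \<open>z = a + s (b - a)\<close> fixes the limits of integration, and the extra terms it
  creates are an exact \<open>s\<close>-derivative; degenerate intervals \<open>a = b\<close> need no separate treatment.\<close>

lemma leibniz_moving_limits: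
  fixes f fy fz :: "real \<Rightarrow> real \<Rightarrow> real"
  assumes "open J" "x \<in> J" and f: "partials_on W f fy fz"
    and ab: "\<And>y. y \<in> J \<Longrightarrow> a y \<le> b y"
    and W: "\<And>y z. y \<in> J \<Longrightarrow> a y \<le> z \<Longrightarrow> z \<le> b y \<Longrightarrow> (y, z) \<in> W"
    and a: "\<And>y. y \<in> J \<Longrightarrow> (a has_real_derivative a' y) (at y)"
    and b: "\<And>y. y \<in> J \<Longrightarrow> (b has_real_derivative b' y) (at y)"
    and a': "continuous_on J a'" and b': "continuous_on J b'"
  shows "((\<lambda>y. integral {a y..b y} (f y)) has_real_derivative
    f x (b x) * b' x - f x (a x) * a' x + integral {a x..b x} (fy x)) (at x)"
proof -
  define c where "c = (\<lambda>y s. a y + s * (b y - a y))"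
  define c' where "c' = (\<lambda>y s. a' y + s * (b' y - a' y))"
  have cW: "(y, c y s) \<in> W" if "y \<in> J" "s \<in> {0..1}" for y s
    using that ab[of y] mult_left_le_one_le[of "b y - a y" s] W[of y "c y s"] by (auto simp: c_def)
  \<comment> \<open>The Leibniz rule for a fixed interval asks for a convex parameter set, so
    \<open>J\<close> is shrunk to a ball around \<open>x\<close>.\<close>
  obtain e where e: "e > 0" "ball x e \<subseteq> J"
    using assms(1,2) open_contains_ball by blast
  define U where "U = ball x e"
  have U: "x \<in> U" "convex U" "open U" "U \<subseteq> J" using e by (auto simp: U_def)
  have ca: "continuous_on J a" "continuous_on J b"
    by (rule DERIV_continuous_on[OF has_field_derivative_at_within[OF a]]
        DERIV_continuous_on[OF has_field_derivative_at_within[OF b]]; assumption)+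
  have cJ: "continuous_on (U \<times> {0..1}) (\<lambda>p. h (fst p))" if "continuous_on J h" for h :: "real \<Rightarrow> real"
    by (rule continuous_on_compose2[OF that]) (use U in \<open>auto intro!: continuous_intros\<close>)
  have cc: "continuous_on (U \<times> {0..1}) (\<lambda>p. c (fst p) (snd p))" "continuous_on (U \<times> {0..1}) (\<lambda>p. c' (fst p) (snd p))"
    unfolding c_def c'_def
    by (intro continuous_intros cJ[OF ca(1)] cJ[OF ca(2)] cJ[OF a'] cJ[OF b'])+
  have pc: "continuous_on (U \<times> {0..1}) (\<lambda>p. h (fst p) (c (fst p) (snd p)))"
    if "continuous_on W (\<lambda>(y, z). h y z)" for h :: "real \<Rightarrow> real \<Rightarrow> real"
    by (rule continuous_on_curve[OF that _ cc(1)]) (use U cW in \<open>auto intro!: continuous_intros\<close>)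
  have cs: "continuous_on {0..1} (\<lambda>s. h y (c y s))"
    if "continuous_on W (\<lambda>(y, z). h y z)" "y \<in> J" for h :: "real \<Rightarrow> real \<Rightarrow> real" and y
    by (rule continuous_on_curve[OF that(1)]) (use that cW in \<open>auto simp: c_def intro!: continuous_intros\<close>)
  have cz: "continuous_on {a y..b y} (h y)"
    if "continuous_on W (\<lambda>(y, z). h y z)" "y \<in> J" for h :: "real \<Rightarrow> real \<Rightarrow> real" and y
    by (rule continuous_on_curve[OF that(1)]) (use that W in \<open>auto intro!: continuous_intros\<close>)
  have cf: "continuous_on W (\<lambda>(y, z). f y z)" "continuous_on W (\<lambda>(y, z). fy y z)" "continuous_on W (\<lambda>(y, z). fz y z)"
    using f partials_on_continuous unfolding partials_on_def by blast+
  define G where "G = (\<lambda>y s. (b y - a y) * f y (c y s))"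
  define G' where "G' = (\<lambda>y s. (b' y - a' y) * f y (c y s) + (b y - a y) * (fy y (c y s) + c' y s * fz y (c y s)))"
  have dG: "((\<lambda>y. G y s) has_real_derivative G' y s) (at y)" if "y \<in> J" "s \<in> {0..1}" for y s
  proof -
    have "((\<lambda>y. c y s) has_real_derivative c' y s) (at y)"
      unfolding c_def c'_def by (auto intro!: derivative_eq_intros a b that)
    from partials_on_chain[OF f _ DERIV_ident this] cW[OF that]
    have "((\<lambda>y. f y (c y s)) has_real_derivative 1 * fy y (c y s) + c' y s * fz y (c y s)) (at y)" by simp
    thus ?thesis unfolding G_def G'_def by (auto intro!: derivative_eq_intros a b that)
  qed
  have cG': "continuous_on (U \<times> cbox 0 1) (\<lambda>(y, s). G' y s)"
    unfolding G'_def case_prod_unfold cbox_interval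
    by (intro continuous_intros cc(2) pc[OF cf(1)] pc[OF cf(2)] pc[OF cf(3)] cJ[OF ca(1)] cJ[OF ca(2)]
      cJ[OF a'] cJ[OF b'])
  have iG: "G y integrable_on cbox 0 1" if "y \<in> J" for y
    unfolding G_def using cs[OF cf(1) that] by (auto intro!: integrable_continuous_real continuous_intros)
  have "((\<lambda>y. integral (cbox 0 1) (G y)) has_real_derivative integral (cbox 0 1) (G' x)) (at x within U)"
    by (rule leibniz_rule_field_derivative[OF _ _ cG' U(1,2)])
      (use U(4) in \<open>auto intro!: has_field_derivative_at_within[OF dG] iG[unfolded cbox_interval]\<close>)
  hence D: "((\<lambda>y. integral {0..1} (G y)) has_real_derivative integral {0..1} (G' x)) (at x)"
    using U by (simp add: at_within_open[of x U])
  have eq: "integral {0..1} (G y) = integral {a y..b y} (f y)" if "y \<in> J" for y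
    unfolding G_def c_def using integral_unit_substitution[OF ab[OF that] cz[OF cf(1) that]] .
  \<comment> \<open>Up to the \<open>fy\<close> term, \<open>G' x\<close> is the derivative of this
    product. As \<open>s\<close> goes from 0 to 1, \<open>c\<close> goes from \<open>a\<close> to
    \<open>b\<close> and \<open>c'\<close> from \<open>a'\<close> to \<open>b'\<close>, so the
    fundamental theorem produces exactly the two boundary terms.\<close>
  have "((\<lambda>s. f x (c x s) * c' x s) has_real_derivative G' x s - (b x - a x) * fy x (c x s)) (at s within {0..1})"
    if "s \<in> {0..1}" for s
  proof -
    have 1: "((\<lambda>s. c x s) has_real_derivative b x - a x) (at s within {0..1})"
      unfolding c_def by (auto intro!: derivative_eq_intros)
    have 2: "((\<lambda>s. c' x s) has_real_derivative b' x - a' x) (at s within {0..1})"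
      unfolding c'_def by (auto intro!: derivative_eq_intros)
    have "((\<lambda>s. f x (c x s)) has_real_derivative 0 * fy x (c x s) + (b x - a x) * fz x (c x s)) (at s within {0..1})"
      by (rule partials_on_chain[OF f _ _ 1]) (use cW[OF assms(2) that] in auto)
    from DERIV_mult[OF this 2] show ?thesis
      by (rule DERIV_cong) (simp add: G'_def algebra_simps)
  qed
  hence I1: "((\<lambda>s. G' x s - (b x - a x) * fy x (c x s)) has_integral f x (c x 1) * c' x 1 - f x (c x 0) * c' x 0) {0..1}"
    by (intro fundamental_theorem_of_calculus) (auto simp: has_real_derivative_iff_has_vector_derivative)
  have I2: "((\<lambda>s. (b x - a x) * fy x (c x s)) has_integral integral {a x..b x} (fy x)) {0..1}"
    unfolding has_integral_iff using integral_unit_substitution[OF ab[OF assms(2)] cz[OF cf(2) assms(2)]]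
      cs[OF cf(2) assms(2)]
    by (auto simp: c_def intro!: integrable_continuous_real continuous_intros)
  have "integral {0..1} (G' x) = f x (c x 1) * c' x 1 - f x (c x 0) * c' x 0 + integral {a x..b x} (fy x)"
    using integral_unique[OF has_integral_add[OF I1 I2]] by simp
  hence "((\<lambda>y. integral {0..1} (G y)) has_real_derivative
      f x (b x) * b' x - f x (a x) * a' x + integral {a x..b x} (fy x)) (at x)"
    using D by (simp add: c_def c'_def)
  thus ?thesis
    by (rule has_field_derivative_transform_within_open[OF _ assms(1,2)]) (rule eq)
qed

section \<open>Smooth functions\<close>

lemma smooth_on_has_derivative:
  assumes "smooth_on A f" "p \<in> A"
  shows "(f has_derivative frechet_derivative f (at p)) (at p)"
proof -
  obtain U where "p \<in> U" "\<forall>k. Ck_on k U f" using assms unfolding smooth_on_def by blast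
  hence "f differentiable (at p)" using Ck_on.simps(2)[of 0 U f] by blast
  thus ?thesis by (simp add: frechet_derivative_works)
qed

lemma smooth_on_frechet_derivative:
  assumes "smooth_on A f"
  shows "smooth_on A (\<lambda>p. frechet_derivative f (at p) v)"
proof -
  obtain U where U: "open U" "A \<subseteq> U" "\<And>k. Ck_on k U f" using assms unfolding smooth_on_def by blast
  have "Ck_on k U (\<lambda>p. frechet_derivative f (at p) v)" for k
    using U(3)[of "Suc k"] by simp
  thus ?thesis using U unfolding smooth_on_def by blast
qed

lemma smooth_on_continuous_on:
  assumes "smooth_on A f"
  shows "continuous_on A f"
  using smooth_on_has_derivative[OF assms] has_derivative_continuous continuous_at_imp_continuous_on by blast

lemma smooth_on_partials_real:
  fixes f :: "real \<Rightarrow> real"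
  assumes "smooth_on A f"
  obtains f' where "smooth_on A f'" "\<And>x. x \<in> A \<Longrightarrow> (f has_real_derivative f' x) (at x)"
proof
  show "smooth_on A (\<lambda>x. frechet_derivative f (at x) 1)"
    by (rule smooth_on_frechet_derivative[OF assms])
  fix x assume "x \<in> A"
  hence d: "(f has_derivative frechet_derivative f (at x)) (at x)"
    by (rule smooth_on_has_derivative[OF assms])
  have "frechet_derivative f (at x) h = frechet_derivative f (at x) 1 * h" for h
    using linear_cmul[OF has_derivative_linear[OF d], of h 1] by simp
  thus "(f has_real_derivative frechet_derivative f (at x) 1) (at x)"
    unfolding has_field_derivative_def by (intro has_derivative_eq_rhs[OF d] ext)
qed

lemma smooth_on_partials_time_strip:
  fixes f :: "real \<Rightarrow> real \<Rightarrow> real"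
  assumes "smooth_on (UNIV \<times> I) (\<lambda>(x, t). f x t)"
  obtains fx ft where "smooth_on (UNIV \<times> I) (\<lambda>(x, t). fx x t)" "smooth_on (UNIV \<times> I) (\<lambda>(x, t). ft x t)"
    "\<And>x t. t \<in> I \<Longrightarrow> ((\<lambda>y. f y t) has_real_derivative fx x t) (at x)"
    "\<And>x t. t \<in> I \<Longrightarrow> ((\<lambda>s. f x s) has_real_derivative ft x t) (at t)"
proof
  let ?F = "\<lambda>(x, t). f x t"
  show "smooth_on (UNIV \<times> I) (\<lambda>(x, t). frechet_derivative ?F (at (x, t)) (1, 0))"
    "smooth_on (UNIV \<times> I) (\<lambda>(x, t). frechet_derivative ?F (at (x, t)) (0, 1))"
    using smooth_on_frechet_derivative[OF assms, of "(1, 0)"] smooth_on_frechet_derivative[OF assms, of "(0, 1)"]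
    by (simp_all add: case_prod_unfold)
  fix x t :: real assume "t \<in> I"
  hence d: "(?F has_derivative frechet_derivative ?F (at (x, t))) (at (x, t))"
    using smooth_on_has_derivative[OF assms, of "(x, t)"] by simp
  note lin = linear_cmul[OF has_derivative_linear[OF d]]
  have L: "frechet_derivative ?F (at (x, t)) (h, 0) = frechet_derivative ?F (at (x, t)) (1, 0) * h"
    "frechet_derivative ?F (at (x, t)) (0, h) = frechet_derivative ?F (at (x, t)) (0, 1) * h" for h
    using lin[of h "(1, 0)"] lin[of h "(0, 1)"] by simp_all
  have "((\<lambda>y. ?F (y, t)) has_derivative (\<lambda>h. frechet_derivative ?F (at (x, t)) (h, 0))) (at x)"
    by (rule has_derivative_compose[where g = ?F and f = "\<lambda>y. (y, t)"])
      (use d in \<open>auto intro!: derivative_eq_intros\<close>)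
  thus "((\<lambda>y. f y t) has_real_derivative frechet_derivative ?F (at (x, t)) (1, 0)) (at x)"
    unfolding has_field_derivative_def prod.case by (rule has_derivative_eq_rhs) (intro ext L)
  have "((\<lambda>s. ?F (x, s)) has_derivative (\<lambda>h. frechet_derivative ?F (at (x, t)) (0, h))) (at t)"
    by (rule has_derivative_compose[where g = ?F and f = "\<lambda>s. (x, s)"])
      (use d in \<open>auto intro!: derivative_eq_intros\<close>)
  thus "((\<lambda>s. f x s) has_real_derivative frechet_derivative ?F (at (x, t)) (0, 1)) (at t)"
    unfolding has_field_derivative_def prod.case by (rule has_derivative_eq_rhs) (intro ext L)
qed

text \<open>\<open>dx f\<close> and \<open>dt f\<close> agree with the smooth partial derivatives
  only at times in \<open>I\<close>. This suffices: an x-derivative freezes the time, so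
  \<open>dx (dx f)\<close> at time \<open>t\<close> depends on \<open>dx f\<close> at that same time
  only.\<close>

lemma smooth_on_strip_dx:
  assumes "smooth_on (UNIV \<times> I) (\<lambda>(x, t). f x t)" "t \<in> I"
  shows "((\<lambda>y. f y t) has_real_derivative dx f x t) (at x)"
    and "((\<lambda>y. dx f y t) has_real_derivative dx (dx f) x t) (at x)"
    and "((\<lambda>s. f x s) has_real_derivative dt f x t) (at t)"
    and "continuous_on UNIV (\<lambda>y. dx f y t)"
    and "continuous_on I (dt f x)"
proof -
  obtain fx ft where f: "smooth_on (UNIV \<times> I) (\<lambda>(x, t). fx x t)" "smooth_on (UNIV \<times> I) (\<lambda>(x, t). ft x t)"
    "\<And>x t. t \<in> I \<Longrightarrow> ((\<lambda>y. f y t) has_real_derivative fx x t) (at x)"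
    "\<And>x t. t \<in> I \<Longrightarrow> ((\<lambda>s. f x s) has_real_derivative ft x t) (at t)"
    by (rule smooth_on_partials_time_strip[OF assms(1)]) (rule that; assumption)
  obtain fxx where fxx: "\<And>x t. t \<in> I \<Longrightarrow> ((\<lambda>y. fx y t) has_real_derivative fxx x t) (at x)"
    by (rule smooth_on_partials_time_strip[OF f(1)]) (rule that; assumption)
  have dx_eq: "dx f y t = fx y t" for y
    unfolding dx_def by (rule DERIV_imp_deriv[OF f(3)[OF assms(2)]])
  have dt_eq: "dt f x s = ft x s" if "s \<in> I" for s
    unfolding dt_def by (rule DERIV_imp_deriv[OF f(4)[OF that]])
  have dxx_eq: "dx (dx f) y t = fxx y t" for y
    unfolding dx_def[of "dx f"] dx_eq by (rule DERIV_imp_deriv[OF fxx[OF assms(2)]])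
  show "((\<lambda>y. f y t) has_real_derivative dx f x t) (at x)"
    unfolding dx_eq by (rule f(3)[OF assms(2)])
  show "((\<lambda>y. dx f y t) has_real_derivative dx (dx f) x t) (at x)"
    unfolding dxx_eq dx_eq by (rule fxx[OF assms(2)])
  show "((\<lambda>s. f x s) has_real_derivative dt f x t) (at t)"
    unfolding dt_eq[OF assms(2)] by (rule f(4)[OF assms(2)])
  have c: "continuous_on (UNIV \<times> I) (\<lambda>(x, t). fx x t)" "continuous_on (UNIV \<times> I) (\<lambda>(x, t). ft x t)"
    using f(1,2) by (auto intro: smooth_on_continuous_on)
  show "continuous_on UNIV (\<lambda>y. dx f y t)"
    unfolding dx_eq by (rule continuous_on_curve[OF c(1)]) (use assms in \<open>auto intro!: continuous_intros\<close>)
  have "continuous_on I (ft x)"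
    by (rule continuous_on_curve[OF c(2), where a = "\<lambda>_. x"]) (auto intro!: continuous_intros)
  thus "continuous_on I (dt f x)"
    by (subst continuous_on_cong[OF refl dt_eq]) auto
qed

lemma smooth_on_real_deriv:
  fixes f :: "real \<Rightarrow> real"
  assumes "smooth_on UNIV f"
  shows "(f has_real_derivative deriv f x) (at x)"
    and "(deriv f has_real_derivative deriv (deriv f) x) (at x)"
    and "continuous_on UNIV (deriv f)"
proof -
  obtain f' where f': "smooth_on UNIV f'" "\<And>x. (f has_real_derivative f' x) (at x)"
    by (rule smooth_on_partials_real[OF assms]) (rule that, auto)
  obtain f'' where f'': "\<And>x. (f' has_real_derivative f'' x) (at x)"
    by (rule smooth_on_partials_real[OF f'(1)]) (rule that, auto)
  have eq: "deriv f = f'" using DERIV_imp_deriv[OF f'(2)] by blast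
  show "(f has_real_derivative deriv f x) (at x)" "(deriv f has_real_derivative deriv (deriv f) x) (at x)"
    "continuous_on UNIV (deriv f)"
    unfolding eq using f'(2) f'' DERIV_imp_deriv[OF f'', of x] smooth_on_continuous_on[OF f'(1)] by auto
qed

text \<open>Restricting the total derivative to a slice gives \<open>partials_on\<close> at a frozen
  time and at a frozen abscissa, with the same \<open>fz\<close>. The partial derivatives are
  returned smooth, so the lemma can be applied to them again.\<close>

lemma smooth_on_partials_space_time:
  fixes f :: "real \<Rightarrow> real \<Rightarrow> real \<Rightarrow> real"
  assumes "smooth_on D (\<lambda>(x, z, t). f x z t)"
  obtains fx fz ft where "smooth_on D (\<lambda>(x, z, t). fx x z t)" "smooth_on D (\<lambda>(x, z, t). fz x z t)"
    "smooth_on D (\<lambda>(x, z, t). ft x z t)"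
    "\<And>t W. (\<And>y z. (y, z) \<in> W \<Longrightarrow> (y, z, t) \<in> D) \<Longrightarrow>
       partials_on W (\<lambda>y z. f y z t) (\<lambda>y z. fx y z t) (\<lambda>y z. fz y z t)"
    "\<And>x W. (\<And>s z. (s, z) \<in> W \<Longrightarrow> (x, z, s) \<in> D) \<Longrightarrow>
       partials_on W (\<lambda>s z. f x z s) (\<lambda>s z. ft x z s) (\<lambda>s z. fz x z s)"
proof
  let ?F = "\<lambda>(x, z, t). f x z t"
  define fx where "fx = (\<lambda>x z t. frechet_derivative ?F (at (x, z, t)) (1, 0, 0))"
  define fz where "fz = (\<lambda>x z t. frechet_derivative ?F (at (x, z, t)) (0, 1, 0))"
  define ft where "ft = (\<lambda>x z t. frechet_derivative ?F (at (x, z, t)) (0, 0, 1))"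
  show S: "smooth_on D (\<lambda>(x, z, t). fx x z t)" "smooth_on D (\<lambda>(x, z, t). fz x z t)" "smooth_on D (\<lambda>(x, z, t). ft x z t)"
    using smooth_on_frechet_derivative[OF assms, of "(1, 0, 0)"] smooth_on_frechet_derivative[OF assms, of "(0, 1, 0)"]
      smooth_on_frechet_derivative[OF assms, of "(0, 0, 1)"]
    by (simp_all add: case_prod_unfold fx_def fz_def ft_def)
  note C = S[THEN smooth_on_continuous_on]
  have d: "(?F has_derivative (\<lambda>(h, k, m). h * fx x z t + k * fz x z t + m * ft x z t)) (at (x, z, t))"
    if "(x, z, t) \<in> D" for x z t
  proof -
    let ?L = "frechet_derivative ?F (at (x, z, t))"
    have d: "(?F has_derivative ?L) (at (x, z, t))"
      using smooth_on_has_derivative[OF assms that] .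
    have "?L (h, k, m) = h * fx x z t + k * fz x z t + m * ft x z t" for h k m
    proof -
      have "(h, k, m) = h *\<^sub>R (1, 0, 0) + k *\<^sub>R (0, 1, 0) + m *\<^sub>R (0, 0, 1)" by simp
      hence "?L (h, k, m) = h *\<^sub>R ?L (1, 0, 0) + k *\<^sub>R ?L (0, 1, 0) + m *\<^sub>R ?L (0, 0, 1)"
        using has_derivative_linear[OF d] by (simp only: linear_add linear_cmul)
      thus ?thesis by (simp add: fx_def fz_def ft_def)
    qed
    hence "?L = (\<lambda>(h, k, m). h * fx x z t + k * fz x z t + m * ft x z t)" by auto
    with d show ?thesis by simp
  qed
  fix W
  show "partials_on W (\<lambda>y z. f y z t) (\<lambda>y z. fx y z t) (\<lambda>y z. fz y z t)"
    if W: "\<And>y z. (y, z) \<in> W \<Longrightarrow> (y, z, t) \<in> D" for t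
  proof -
    have "((\<lambda>(y, z). f y z t) has_derivative (\<lambda>(h, k). h * fx y z t + k * fz y z t)) (at (y, z))"
      if "(y, z) \<in> W" for y z
    proof -
      have "((\<lambda>p. ?F (fst p, snd p, t)) has_derivative
          (\<lambda>v. (\<lambda>(h, k, m). h * fx y z t + k * fz y z t + m * ft y z t) (fst v, snd v, 0))) (at (y, z))"
        by (rule has_derivative_compose[of "\<lambda>p. (fst p, snd p, t)"])
          (use d[OF W[OF that]] in \<open>auto intro!: derivative_eq_intros\<close>)
      thus ?thesis by (simp add: case_prod_unfold)
    qed
    moreover have "continuous_on W (\<lambda>(y, z). h y z t)" if "continuous_on D (\<lambda>(x, z, t). h x z t)" for h :: "real \<Rightarrow> real \<Rightarrow> real \<Rightarrow> real"
    proof -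
      have "continuous_on W (\<lambda>p. (\<lambda>(x, z, t). h x z t) (fst p, snd p, t))"
        by (rule continuous_on_compose2[OF that]) (use W in \<open>auto intro!: continuous_intros\<close>)
      thus ?thesis by (simp add: case_prod_unfold)
    qed
    ultimately show ?thesis using C unfolding partials_on_def by auto
  qed
  show "partials_on W (\<lambda>s z. f x z s) (\<lambda>s z. ft x z s) (\<lambda>s z. fz x z s)"
    if W: "\<And>s z. (s, z) \<in> W \<Longrightarrow> (x, z, s) \<in> D" for x
  proof -
    have "((\<lambda>(s, z). f x z s) has_derivative (\<lambda>(h, k). h * ft x z s + k * fz x z s)) (at (s, z))"
      if "(s, z) \<in> W" for s z
    proof -
      have "((\<lambda>p. ?F (x, snd p, fst p)) has_derivative
          (\<lambda>v. (\<lambda>(h, k, m). h * fx x z s + k * fz x z s + m * ft x z s) (0, snd v, fst v))) (at (s, z))"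
        by (rule has_derivative_compose[of "\<lambda>p. (x, snd p, fst p)"])
          (use d[OF W[OF that]] in \<open>auto intro!: derivative_eq_intros\<close>)
      thus ?thesis by (simp add: case_prod_unfold add.commute)
    qed
    moreover have "continuous_on W (\<lambda>(s, z). h x z s)" if "continuous_on D (\<lambda>(x, z, t). h x z t)" for h :: "real \<Rightarrow> real \<Rightarrow> real \<Rightarrow> real"
    proof -
      have "continuous_on W (\<lambda>p. (\<lambda>(x, z, t). h x z t) (x, snd p, fst p))"
        by (rule continuous_on_compose2[OF that]) (use W in \<open>auto intro!: continuous_intros\<close>)
      thus ?thesis by (simp add: case_prod_unfold)
    qed
    ultimately show ?thesis using C unfolding partials_on_def by auto
  qed
qed

section \<open>Second x-derivatives at a frozen time\<close>

definition twice_dx :: "real \<Rightarrow> (real \<Rightarrow> real \<Rightarrow> real) \<Rightarrow> bool" where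
  "twice_dx t f \<longleftrightarrow> (\<forall>x. ((\<lambda>y. f y t) has_real_derivative dx f x t) (at x) \<and>
     ((\<lambda>y. dx f y t) has_real_derivative dx (dx f) x t) (at x))"

lemma twice_dxD:
  assumes "twice_dx t f"
  shows "((\<lambda>y. f y t) has_real_derivative dx f x t) (at x)"
    and "((\<lambda>y. dx f y t) has_real_derivative dx (dx f) x t) (at x)"
  using assms unfolding twice_dx_def by auto

text \<open>\<open>deriv\<close> is total, so \<open>dx f\<close> has values even where no
  derivative exists; \<open>twice_dx\<close> certifies that the values are genuine. The premises
  range over all \<open>x\<close> because the second derivative differentiates the function
  \<open>dx f\<close>, not a single value.\<close>

lemma twice_dxI:
  assumes "\<And>x. ((\<lambda>y. f y t) has_real_derivative f' x) (at x)" "\<And>x. (f' has_real_derivative f'' x) (at x)"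
  shows "twice_dx t f" "dx f x t = f' x" "dx (dx f) x t = f'' x"
proof -
  have 1: "dx f y t = f' y" for y unfolding dx_def by (rule DERIV_imp_deriv[OF assms(1)])
  have 2: "dx (dx f) y t = f'' y" for y
    unfolding dx_def[of "dx f"] 1 by (rule DERIV_imp_deriv[OF assms(2)])
  show "twice_dx t f" "dx f x t = f' x" "dx (dx f) x t = f'' x"
    using assms unfolding twice_dx_def 1 2 by auto
qed

lemma twice_dx_smooth: "smooth_on (UNIV \<times> I) (\<lambda>(x, t). f x t) \<Longrightarrow> t \<in> I \<Longrightarrow> twice_dx t f"
  unfolding twice_dx_def using smooth_on_strip_dx(1,2) by blast

lemma twice_dx_mult:
  assumes "twice_dx t f" "twice_dx t g"
  shows "twice_dx t (\<lambda>x t. f x t * g x t)"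
    and "dx (\<lambda>x t. f x t * g x t) x t = dx f x t * g x t + f x t * dx g x t"
    and "dx (dx (\<lambda>x t. f x t * g x t)) x t = dx (dx f) x t * g x t + 2 * dx f x t * dx g x t + f x t * dx (dx g) x t"
proof -
  have 1: "((\<lambda>y. f y t * g y t) has_real_derivative dx f x t * g x t + f x t * dx g x t) (at x)" for x
    using DERIV_mult[OF twice_dxD(1)[OF assms(1)] twice_dxD(1)[OF assms(2)], of x] by (simp add: mult.commute)
  have 2: "((\<lambda>y. dx f y t * g y t + f y t * dx g y t) has_real_derivative
      dx (dx f) x t * g x t + 2 * dx f x t * dx g x t + f x t * dx (dx g) x t) (at x)" for x
    by (rule DERIV_cong[OF DERIV_add[OF DERIV_mult[OF twice_dxD(2)[OF assms(1)] twice_dxD(1)[OF assms(2)]]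
        DERIV_mult[OF twice_dxD(1)[OF assms(1)] twice_dxD(2)[OF assms(2)]]]]) (simp add: algebra_simps)
  note R = twice_dxI[where f = "\<lambda>x t. f x t * g x t" and t = t, OF 1 2]
  show "twice_dx t (\<lambda>x t. f x t * g x t)"
    "dx (\<lambda>x t. f x t * g x t) x t = dx f x t * g x t + f x t * dx g x t"
    "dx (dx (\<lambda>x t. f x t * g x t)) x t = dx (dx f) x t * g x t + 2 * dx f x t * dx g x t + f x t * dx (dx g) x t"
    by (rule R)+
qed

lemma twice_dx_sum:
  assumes "\<And>j. j \<in> A \<Longrightarrow> twice_dx t (f j)"
  shows "twice_dx t (\<lambda>x t. \<Sum>j\<in>A. f j x t)"
    and "dx (\<lambda>x t. \<Sum>j\<in>A. f j x t) x t = (\<Sum>j\<in>A. dx (f j) x t)"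
    and "dx (dx (\<lambda>x t. \<Sum>j\<in>A. f j x t)) x t = (\<Sum>j\<in>A. dx (dx (f j)) x t)"
proof -
  have 1: "((\<lambda>y. \<Sum>j\<in>A. f j y t) has_real_derivative (\<Sum>j\<in>A. dx (f j) x t)) (at x)"
    and 2: "((\<lambda>y. \<Sum>j\<in>A. dx (f j) y t) has_real_derivative (\<Sum>j\<in>A. dx (dx (f j)) x t)) (at x)" for x
    by (intro DERIV_sum twice_dxD assms; assumption)+
  note R = twice_dxI[where f = "\<lambda>x t. \<Sum>j\<in>A. f j x t" and t = t, OF 1 2]
  show "twice_dx t (\<lambda>x t. \<Sum>j\<in>A. f j x t)"
    "dx (\<lambda>x t. \<Sum>j\<in>A. f j x t) x t = (\<Sum>j\<in>A. dx (f j) x t)"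
    "dx (dx (\<lambda>x t. \<Sum>j\<in>A. f j x t)) x t = (\<Sum>j\<in>A. dx (dx (f j)) x t)"
    by (rule R)+
qed

section \<open>Sums over the layers and the energy identity of one layer\<close>

lemma sum_diff_shift:
  fixes p r :: "nat \<Rightarrow> real"
  assumes "1 \<le> N"
  shows "(\<Sum>\<alpha>=1..N. p \<alpha> - r \<alpha>) = p N - r 1 + (\<Sum>\<alpha>=1..N-1. p \<alpha> - r (\<alpha> + 1))"
  using assms by (induction N rule: dec_induct) (auto simp: sum.cl_ivl_Suc Suc_le_eq split: nat_diff_split dest: gr0_implies_Suc)

text \<open>Both sides are the sum of \<open>a i * b j\<close> over all pairs i < j in
  \<open>{1..N}\<close>; the induction step adds the pairs with j = \<open>Suc N\<close>.\<close>

lemma sum_upper_lower_swap: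
  fixes a b :: "nat \<Rightarrow> real"
  shows "(\<Sum>\<alpha>=1..N. a \<alpha> * (\<Sum>j=\<alpha>+1..N. b j)) = (\<Sum>\<alpha>=1..N. b \<alpha> * (\<Sum>j=1..\<alpha>-1. a j))"
proof (induction N)
  case (Suc N)
  have "(\<Sum>\<alpha>=1..N. a \<alpha> * (\<Sum>j=\<alpha>+1..Suc N. b j)) = (\<Sum>\<alpha>=1..N. a \<alpha> * (\<Sum>j=\<alpha>+1..N. b j) + a \<alpha> * b (Suc N))"
    by (rule sum.cong) (auto simp: distrib_left)
  thus ?case using Suc by (simp add: sum.distrib sum_distrib_right sum_distrib_left mult.commute)
qed simp

text \<open>The work of the momentum equation against \<open>U\<close> in one layer. The remainders on the right
  cancel when summed over the layers: \<open>M\<close> collects the momentum exchanged and \<open>s\<close> the jump of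
  \<open>\<sigma>\<close>; \<open>Rx\<close> and \<open>Q\<close> carry the dependence on the layers above and below.\<close>

lemma layer_energy_identity:
  fixes U :: real
  assumes mom: "ht * U + h * Ut + (hx * U\<^sup>2 + 2 * h * U * Ux + g / 2 * (hx * H + h * Hx)) =
      - g * h * bx + M + (Px + zxx * T + 2 * zx * Tx + z * Txx)
      + (z + h / 2) * Rxx - (z - h / 2) * (Txx + Rxx) + s"
    and V: "V = - (1 / 2) * qx - Q + U * zx" and qx: "qx = hx * U + h * Ux"
    and h: "h = k * H" "hx = k * Hx"
  shows "ht * U\<^sup>2 / 2 + h * U * Ut
      + (Ux * (h * (U\<^sup>2 / 2 + g * z) + g / 2 * h * H - P - (zx * T + h * (Tx / 2 + Rx)))
         + U * (hx * (U\<^sup>2 / 2 + g * z) + h * (U * Ux + g * zx) + g / 2 * (hx * H + h * Hx) - Px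
            - (zxx * T + zx * Tx + hx * (Tx / 2 + Rx) + h * (Txx / 2 + Rxx))) - (Vx * T + V * Tx))
      + (Ux * P + (Vx + zx * Ux) * T)
      - g * (qx * (z + H / 2 - (b + H)) + h * U * (zx + Hx / 2 - (bx + Hx)))
    = U * M - U\<^sup>2 / 2 * (ht + qx) + U * s - (qx * Rx - Tx * Q) + g * (b + H) * qx"
proof -
  have "U * (ht * U + h * Ut + (hx * U\<^sup>2 + 2 * h * U * Ux + g / 2 * (hx * H + h * Hx))) =
    U * (- g * h * bx + M + (Px + zxx * T + 2 * zx * Tx + z * Txx)
      + (z + h / 2) * Rxx - (z - h / 2) * (Txx + Rxx) + s)"
    using mom by simp
  \<comment> \<open>Proportionality of \<open>h\<close> and \<open>H\<close> gives
    \<open>hx * H = h * Hx\<close>, so the pressure gradient becomes \<open>g * h * Hx\<close> and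
    joins \<open>bx\<close> to form the slope of the free surface. \<open>Vx\<close> cancels between
    flux and dissipation, so only the value of \<open>V\<close> has to be substituted.\<close>
  thus ?thesis
    unfolding V qx h by (simp add: power2_eq_square algebra_simps add_divide_distrib diff_divide_distrib)
qed

lemma deriv_sum:
  fixes f :: "'a \<Rightarrow> real \<Rightarrow> real"
  assumes "\<And>j. j \<in> A \<Longrightarrow> (f j has_real_derivative f' j) (at x)"
  shows "deriv (\<lambda>y. \<Sum>j\<in>A. f j y) x = (\<Sum>j\<in>A. f' j)"
  by (rule DERIV_imp_deriv, rule DERIV_sum, rule assms)

section \<open>Averaging over the layers\<close>

locale layering =
  fixes N :: nat and l :: "nat \<Rightarrow> real" and zb :: "real \<Rightarrow> real"
    and I :: "real set" and H :: "real \<Rightarrow> real \<Rightarrow> real"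
  assumes N: "1 \<le> N" and l_pos: "\<And>j. j \<in> {1..N} \<Longrightarrow> 0 < l j" and l_sum: "(\<Sum>j=1..N. l j) = 1"
    and I: "open I" and zb: "smooth_on UNIV zb"
    and H: "smooth_on (UNIV \<times> I) (\<lambda>(x, t). H x t)" and H_pos: "\<And>x t. t \<in> I \<Longrightarrow> 0 < H x t"
begin

abbreviation face where "face \<equiv> z_face l zb H"

text \<open>The relative height of an interface in the water column, constant in space and time. It
  makes every derivative of an interface an explicit combination of derivatives of \<open>zb\<close>
  and \<open>H\<close>.\<close>

definition frac :: "nat \<Rightarrow> real" where "frac \<alpha> = (\<Sum>j=1..\<alpha>. l j)"

lemma frac_0 [simp]: "frac 0 = 0"
  by (simp add: frac_def)

lemma frac_N [simp]: "frac N = 1"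
  unfolding frac_def by (rule l_sum)

lemma frac_step: "1 \<le> \<alpha> \<Longrightarrow> frac \<alpha> = frac (\<alpha> - 1) + l \<alpha>"
  unfolding frac_def by (cases \<alpha>) auto

lemma frac_mono:
  assumes "\<alpha> \<le> \<beta>" "\<beta> \<le> N"
  shows "frac \<alpha> \<le> frac \<beta>"
  unfolding frac_def by (rule sum_mono2) (use assms l_pos in \<open>auto intro: less_imp_le\<close>)

lemma face_eq: "face \<alpha> x t = zb x + frac \<alpha> * H x t"
  by (simp add: z_face_def frac_def sum_distrib_right)

lemma face_0 [simp]: "face 0 x t = zb x" and face_N: "face N x t = zb x + H x t"
  by (simp_all add: face_eq)

lemma face_mono:
  assumes "\<alpha> \<le> \<beta>" "\<beta> \<le> N" "t \<in> I"
  shows "face \<alpha> x t \<le> face \<beta> x t"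
  using frac_mono[OF assms(1,2)] H_pos[OF assms(3), of x] by (simp add: face_eq)

lemma face_step: "1 \<le> \<alpha> \<Longrightarrow> face \<alpha> x t = face (\<alpha> - 1) x t + layer_h l H \<alpha> x t"
  by (simp add: face_eq layer_h_def frac_step algebra_simps)

definition face_x where "face_x \<alpha> x t = deriv zb x + frac \<alpha> * dx H x t"

definition face_xx where "face_xx \<alpha> x t = deriv (deriv zb) x + frac \<alpha> * dx (dx H) x t"

definition face_t where "face_t \<alpha> x t = frac \<alpha> * dt H x t"

lemmas H_derivs = smooth_on_strip_dx[OF H]
lemmas zb_derivs = smooth_on_real_deriv[OF zb]

lemma face_has_dx:
  assumes "t \<in> I"
  shows "((\<lambda>y. face \<alpha> y t) has_real_derivative face_x \<alpha> x t) (at x)"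
  unfolding face_eq face_x_def
  by (auto intro!: derivative_eq_intros zb_derivs(1) H_derivs(1) assms)

lemma face_x_has_dx:
  assumes "t \<in> I"
  shows "((\<lambda>y. face_x \<alpha> y t) has_real_derivative face_xx \<alpha> x t) (at x)"
  unfolding face_x_def face_xx_def
  by (auto intro!: derivative_eq_intros zb_derivs(2) H_derivs(2) assms)

lemma face_has_dt:
  assumes "t \<in> I"
  shows "((\<lambda>s. face \<alpha> x s) has_real_derivative face_t \<alpha> x t) (at t)"
  unfolding face_eq face_t_def
  by (auto intro!: derivative_eq_intros H_derivs(3) assms)

lemma continuous_on_face_x: "t \<in> I \<Longrightarrow> continuous_on UNIV (\<lambda>y. face_x \<alpha> y t)"
  unfolding face_x_def by (intro continuous_intros zb_derivs(3) H_derivs(4))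

lemma continuous_on_face_t: "continuous_on I (face_t \<alpha> x)"
\<comment> \<open>\<open>H_derivs\<close> is stated for some time in \<open>I\<close>, so such a
  time has to be exhibited first.\<close>
proof (cases "I = {}")
  case False
  then obtain t where "t \<in> I" by blast
  thus ?thesis unfolding face_t_def by (intro continuous_intros H_derivs(5))
qed simp

lemma dx_face: "t \<in> I \<Longrightarrow> dx (face \<alpha>) x t = face_x \<alpha> x t"
  unfolding dx_def by (rule DERIV_imp_deriv[OF face_has_dx])

section \<open>Integrals between interfaces\<close>

definition band where "band t = {(y, z). zb y \<le> z \<and> z \<le> face N y t}"

definition tband where "tband x = {(s, z). s \<in> I \<and> zb x \<le> z \<and> z \<le> face N x s}"

lemma between_faces_in_band:
  assumes "\<alpha> \<le> N" "\<beta> \<le> N" "t \<in> I" "face \<alpha> x t \<le> z" "z \<le> face \<beta> x t"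
  shows "(x, z) \<in> band t" "(t, z) \<in> tband x"
  using face_mono[of 0 \<alpha> t x] face_mono[of \<beta> N t x] assms unfolding band_def tband_def by auto

lemma face_in_band:
  assumes "\<alpha> \<le> N" "t \<in> I"
  shows "(x, face \<alpha> x t) \<in> band t"
  using between_faces_in_band(1)[OF assms(1,1,2)] by simp

lemma leibniz_face_dx:
  assumes "t \<in> I" "\<alpha> \<le> \<beta>" "\<beta> \<le> N" "partials_on (band t) f fy fz"
  shows "((\<lambda>y. integral {face \<alpha> y t..face \<beta> y t} (f y)) has_real_derivative
    f x (face \<beta> x t) * face_x \<beta> x t - f x (face \<alpha> x t) * face_x \<alpha> x t
      + integral {face \<alpha> x t..face \<beta> x t} (fy x)) (at x)"
  by (rule leibniz_moving_limits[OF open_UNIV UNIV_I assms(4)])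
    (use assms face_mono face_has_dx continuous_on_face_x between_faces_in_band(1)[of \<alpha> \<beta>] in auto)

lemma leibniz_face_dt:
  assumes "t \<in> I" "\<alpha> \<le> \<beta>" "\<beta> \<le> N" "partials_on (tband x) f fs fz"
  shows "((\<lambda>s. integral {face \<alpha> x s..face \<beta> x s} (f s)) has_real_derivative
    f t (face \<beta> x t) * face_t \<beta> x t - f t (face \<alpha> x t) * face_t \<alpha> x t
      + integral {face \<alpha> x t..face \<beta> x t} (fs t)) (at t)"
  by (rule leibniz_moving_limits[OF I assms(1,4)])
    (use assms face_mono face_has_dt continuous_on_face_t between_faces_in_band(2)[of \<alpha> \<beta>] in auto)

lemma continuous_on_layers:
  assumes "\<alpha> \<le> N" "\<beta> \<le> N" "t \<in> I" "continuous_on (band t) (\<lambda>(y, z). f y z)"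
  shows "continuous_on {face \<alpha> x t..face \<beta> x t} (f x :: real \<Rightarrow> real)"
  by (rule continuous_on_curve[OF assms(4), where a = "\<lambda>_. x"])
    (use assms between_faces_in_band(1)[of \<alpha> \<beta>] in \<open>auto intro!: continuous_intros\<close>)

lemma sum_layers:
  assumes "t \<in> I" "\<beta> \<le> N" "continuous_on (band t) (\<lambda>(y, z). f y z)" "\<alpha> \<le> \<beta>"
  shows "(\<Sum>j=\<alpha>+1..\<beta>. integral {face (j - 1) x t..face j x t} (f x :: real \<Rightarrow> real)) =
    integral {face \<alpha> x t..face \<beta> x t} (f x)"
  using assms(4,2)
proof (induction \<beta> rule: dec_induct)
  case (step n)
  have "integral {face \<alpha> x t..face n x t} (f x) + integral {face n x t..face (Suc n) x t} (f x)
      = integral {face \<alpha> x t..face (Suc n) x t} (f x)"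
    by (rule Henstock_Kurzweil_Integration.integral_combine)
      (use step assms(1,3) in \<open>auto intro!: face_mono integrable_continuous_real continuous_on_layers\<close>)
  with step show ?case by simp
qed simp

section \<open>Second derivatives of integrals and the non-local stress term\<close>

definition trace_x where
  "trace_x f fy fz \<alpha> x t = (face_x \<alpha> x t * fz x (face \<alpha> x t) + fy x (face \<alpha> x t)) * face_x \<alpha> x t
     + f x (face \<alpha> x t) * face_xx \<alpha> x t"

text \<open>The product is the boundary term that the Leibniz rule creates at an interface;
  \<open>trace_x\<close> is what it becomes when the rule is applied a second time.\<close>

lemma trace_has_dx:
  assumes "t \<in> I" "\<alpha> \<le> N" "partials_on (band t) f fy fz"
  shows "((\<lambda>y. f y (face \<alpha> y t) * face_x \<alpha> y t) has_real_derivative trace_x f fy fz \<alpha> x t) (at x)"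
proof -
  have "((\<lambda>y. f y (face \<alpha> y t)) has_real_derivative 1 * fy x (face \<alpha> x t) + face_x \<alpha> x t * fz x (face \<alpha> x t)) (at x)"
    by (rule partials_on_chain[OF assms(3) face_in_band[OF assms(2,1)] DERIV_ident face_has_dx[OF assms(1)]])
  from DERIV_mult[OF this face_x_has_dx[OF assms(1)]] show ?thesis
    by (rule DERIV_cong) (simp add: trace_x_def algebra_simps)
qed

lemma face_integral_has_dxx:
  assumes t: "t \<in> I" and ab: "\<alpha> \<le> \<beta>" "\<beta> \<le> N"
    and f: "partials_on (band t) f fy fz" "partials_on (band t) fy fyy fyz"
  shows "((\<lambda>y. deriv (\<lambda>y. integral {face \<alpha> y t..face \<beta> y t} (f y)) y) has_real_derivative
      trace_x f fy fz \<beta> x t - trace_x f fy fz \<alpha> x t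
      + fy x (face \<beta> x t) * face_x \<beta> x t - fy x (face \<alpha> x t) * face_x \<alpha> x t
      + integral {face \<alpha> x t..face \<beta> x t} (fyy x)) (at x)"
proof -
  have "(\<lambda>y. deriv (\<lambda>y. integral {face \<alpha> y t..face \<beta> y t} (f y)) y) =
      (\<lambda>y. f y (face \<beta> y t) * face_x \<beta> y t - f y (face \<alpha> y t) * face_x \<alpha> y t
        + integral {face \<alpha> y t..face \<beta> y t} (fy y))"
    by (intro ext DERIV_imp_deriv leibniz_face_dx[OF t ab f(1)])
  moreover have "\<alpha> \<le> N" using ab by simp
  note DERIV_add[OF DERIV_diff[OF trace_has_dx[OF t ab(2) f(1)] trace_has_dx[OF t this f(1)]]
      leibniz_face_dx[OF t ab f(2)], of x]
  ultimately show ?thesis by (simp only: add_diff_eq add.assoc[symmetric])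
qed

text \<open>With \<open>z\<close> held fixed, the integral has a proper interval only at abscissas
  where \<open>z\<close> lies strictly inside the fluid. Strictness makes that set open, hence the
  Leibniz rule applies on it, and the constant lower limit contributes no trace.\<close>

lemma height_integral_dxx:
  assumes t: "t \<in> I" and z: "zb x < z" "z < face N x t"
    and f: "partials_on (band t) f fy fz" "partials_on (band t) fy fyy fyz"
  shows "deriv (\<lambda>y. deriv (\<lambda>y. integral {z..face N y t} (f y)) y) x =
    trace_x f fy fz N x t + fy x (face N x t) * face_x N x t + integral {z..face N x t} (fyy x)"
proof -
  define J where "J = {y. zb y < z \<and> z < face N y t}"
  have c: "continuous_on UNIV zb" "continuous_on UNIV (\<lambda>y. face N y t)"
    by (rule DERIV_continuous_on[OF has_field_derivative_at_within], rule zb_derivs face_has_dx[OF t])+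
  have J: "open J" "x \<in> J"
    using z c unfolding J_def by (auto intro!: open_Collect_conj open_Collect_less)
  have lim: "((\<lambda>y. integral {z..face N y t} (h y)) has_real_derivative
      h x (face N x t) * face_x N x t - h x z * 0 + integral {z..face N x t} (hy x)) (at x)"
    if "partials_on (band t) h hy hz" "x \<in> J" for h hy hz x
    by (rule leibniz_moving_limits[OF J(1) that(2,1)])
      (use face_has_dx[OF t] continuous_on_subset[OF continuous_on_face_x[OF t]] in \<open>auto simp: J_def band_def\<close>)
  have "((\<lambda>y. f y (face N y t) * face_x N y t + integral {z..face N y t} (fy y)) has_real_derivative
      trace_x f fy fz N x t + (fy x (face N x t) * face_x N x t - fy x z * 0 + integral {z..face N x t} (fyy x))) (at x)"
    by (rule DERIV_add[OF trace_has_dx[OF t order_refl f(1)] lim[OF f(2) J(2)]])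
  hence "((\<lambda>y. deriv (\<lambda>y. integral {z..face N y t} (f y)) y) has_real_derivative
      trace_x f fy fz N x t + (fy x (face N x t) * face_x N x t - fy x z * 0 + integral {z..face N x t} (fyy x))) (at x)"
    by (rule has_field_derivative_transform_within_open[OF _ J]) (use DERIV_imp_deriv[OF lim[OF f(1)]] in simp)
  thus ?thesis by (simp add: DERIV_imp_deriv)
qed

text \<open>Integration by parts: the upper integral has z-derivative \<open>- h x z\<close>, so its
  product with \<open>z\<close> is a primitive of the difference between it and
  \<open>z * h x z\<close>.\<close>

lemma upper_integral_moment:
  assumes t: "t \<in> I" and ab: "\<alpha> \<le> \<beta>" "\<beta> \<le> N" and h: "continuous_on (band t) (\<lambda>(y, z). h y z)"
  shows "((\<lambda>z. integral {z..face N x t} (h x)) has_integral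
      face \<beta> x t * integral {face \<beta> x t..face N x t} (h x)
      - face \<alpha> x t * integral {face \<alpha> x t..face N x t} (h x)
      + integral {face \<alpha> x t..face \<beta> x t} (\<lambda>z. z * h x z)) {face \<alpha> x t..face \<beta> x t}"
proof -
  let ?a = "face \<alpha> x t" and ?b = "face \<beta> x t" and ?e = "face N x t"
  define K where "K = (\<lambda>z. integral {z..?e} (h x))"
  have le: "?a \<le> ?b" "?b \<le> ?e" using face_mono[OF _ _ t] ab by auto
  have ch: "continuous_on {?a..?e} (h x)" "continuous_on {?a..?b} (h x)"
    using continuous_on_layers[OF _ _ t h] ab by auto
  have "(K has_real_derivative - h x z) (at z within {?a..?b})" if "z \<in> {?a..?b}" for z
    unfolding K_def
    by (rule DERIV_subset[OF integral_has_real_derivative'[OF ch(1)]]) (use that le in auto)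
  hence "((\<lambda>z. z * K z) has_real_derivative K z - z * h x z) (at z within {?a..?b})" if "z \<in> {?a..?b}" for z
    using that by (auto intro!: derivative_eq_intros)
  hence I1: "((\<lambda>z. K z - z * h x z) has_integral ?b * K ?b - ?a * K ?a) {?a..?b}"
    using le by (intro fundamental_theorem_of_calculus) (auto simp: has_real_derivative_iff_has_vector_derivative)
  have I2: "((\<lambda>z. z * h x z) has_integral integral {?a..?b} (\<lambda>z. z * h x z)) {?a..?b}"
    using ch(2) by (auto intro!: integrable_integral integrable_continuous_real continuous_intros)
  show ?thesis using has_integral_add[OF I1 I2] by (simp add: K_def)
qed

text \<open>Integrating by parts in \<open>z\<close>, both sides reduce to integrals of the second \<open>x\<close>-derivative of
  \<open>f\<close> and to traces of \<open>f\<close> on the interfaces; the surplus of traces is the slope-squared part of \<open>\<sigma>\<close>.\<close>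

lemma height_integral_layer_average:
  fixes x :: real
  assumes t: "t \<in> I" and \<alpha>: "\<alpha> \<in> {1..N}"
    and f: "partials_on (band t) f fy fz" "partials_on (band t) fy fyy fyz"
  defines "a \<equiv> face (\<alpha> - 1) x t" and "b \<equiv> face \<alpha> x t"
  shows "((\<lambda>z. deriv (\<lambda>y. deriv (\<lambda>y. integral {z..face N y t} (f y)) y) x) has_integral
      deriv (\<lambda>y. deriv (\<lambda>y. integral {face (\<alpha> - 1) y t..face \<alpha> y t} (\<lambda>z. z * f y z)) y) x
      + b * deriv (\<lambda>y. deriv (\<lambda>y. integral {face \<alpha> y t..face N y t} (f y)) y) x
      - a * deriv (\<lambda>y. deriv (\<lambda>y. integral {face (\<alpha> - 1) y t..face N y t} (f y)) y) x
      - (face_x \<alpha> x t)\<^sup>2 * f x b + (face_x (\<alpha> - 1) x t)\<^sup>2 * f x a) {a..b}"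
proof -
  \<comment> \<open>The part of the second derivative that does not depend on \<open>z\<close>: it
    consists of surface traces only, and will match the surface traces in the two integrals up to
    \<open>face N\<close>.\<close>
  define B where "B = trace_x f fy fz N x t + fy x (face N x t) * face_x N x t"
  have le: "\<alpha> - 1 \<le> \<alpha>" "\<alpha> \<le> N" "\<alpha> - 1 \<le> N" using \<alpha> by auto
  have ab: "a \<le> b" "zb x \<le> a" "b \<le> face N x t"
    unfolding a_def b_def using face_mono[OF le(1,2) t] face_mono[OF _ le(3) t, of 0] face_mono[OF le(2) _ t] by auto
  have zf: "partials_on (band t) (\<lambda>y z. z * f y z) (\<lambda>y z. z * fy y z) (\<lambda>y z. f y z + z * fz y z)"
    "partials_on (band t) (\<lambda>y z. z * fy y z) (\<lambda>y z. z * fyy y z) (\<lambda>y z. fy y z + z * fyz y z)"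
    using partials_on_mult[OF partials_on_proj_snd f(1)] partials_on_mult[OF partials_on_proj_snd f(2)] by simp_all
  have cyy: "continuous_on (band t) (\<lambda>(y, z). fyy y z)" using f(2) unfolding partials_on_def by blast
  note D = DERIV_imp_deriv[OF face_integral_has_dxx[OF t]]
  have "((\<lambda>z. B + integral {z..face N x t} (fyy x)) has_integral (b - a) * B +
      (b * integral {b..face N x t} (fyy x) - a * integral {a..face N x t} (fyy x)
       + integral {a..b} (\<lambda>z. z * fyy x z))) {a..b}"
    using has_integral_add[OF has_integral_const_real[of B "face (\<alpha> - 1) x t" "face \<alpha> x t"] upper_integral_moment[OF t le(1,2) cyy, of x]] ab
    by (simp add: a_def b_def)
  \<comment> \<open>At the upper interface, the trace of the moment \<open>z * f\<close> is
    \<open>b\<close> times the trace of \<open>f\<close> plus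
    \<open>(face_x \<alpha> x t)\<^sup>2 * f x b\<close>, the latter from differentiating the factor
    \<open>z\<close> along the interface. The first part cancels against the lower end of the
    integral multiplied by \<open>b\<close>; only the slope-squared term survives. The same happens
    at \<open>a\<close> with opposite sign.\<close>
  also have "(b - a) * B + (b * integral {b..face N x t} (fyy x) - a * integral {a..face N x t} (fyy x)
       + integral {a..b} (\<lambda>z. z * fyy x z)) =
      deriv (\<lambda>y. deriv (\<lambda>y. integral {face (\<alpha> - 1) y t..face \<alpha> y t} (\<lambda>z. z * f y z)) y) x
      + b * deriv (\<lambda>y. deriv (\<lambda>y. integral {face \<alpha> y t..face N y t} (f y)) y) x
      - a * deriv (\<lambda>y. deriv (\<lambda>y. integral {face (\<alpha> - 1) y t..face N y t} (f y)) y) x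
      - (face_x \<alpha> x t)\<^sup>2 * f x b + (face_x (\<alpha> - 1) x t)\<^sup>2 * f x a"
    unfolding D[OF le(1,2) zf] D[OF le(2) order_refl f] D[OF le(3) order_refl f] B_def
    by (simp add: trace_x_def a_def b_def power2_eq_square algebra_simps)
  finally show ?thesis
    \<comment> \<open>At the end points \<open>z\<close> may be the bottom or the surface, where
      \<open>height_integral_dxx\<close> says nothing; two points do not affect the
      integral.\<close>
    by (rule has_integral_spike_interior[of _ _ a b, unfolded cbox_interval box_real])
      (use height_integral_dxx[OF t _ _ f] ab in \<open>auto simp: B_def\<close>)
qed

section \<open>Layer averages of fields and their derivatives\<close>

lemma fluid_partials:
  assumes "smooth_on (fluid_domain zb H I) (\<lambda>(x, z, t). f x z t)"
  obtains fx fz ft where "smooth_on (fluid_domain zb H I) (\<lambda>(x, z, t). fx x z t)"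
    "\<And>t. t \<in> I \<Longrightarrow> partials_on (band t) (\<lambda>y z. f y z t) (\<lambda>y z. fx y z t) (\<lambda>y z. fz y z t)"
    "\<And>x. partials_on (tband x) (\<lambda>s z. f x z s) (\<lambda>s z. ft x z s) (\<lambda>s z. fz x z s)"
proof (rule smooth_on_partials_space_time[OF assms])
  fix fx fz ft
  assume 1: "smooth_on (fluid_domain zb H I) (\<lambda>(x, z, t). fx x z t)"
    and 2: "\<And>t W. (\<And>y z. (y, z) \<in> W \<Longrightarrow> (y, z, t) \<in> fluid_domain zb H I) \<Longrightarrow>
       partials_on W (\<lambda>y z. f y z t) (\<lambda>y z. fx y z t) (\<lambda>y z. fz y z t)"
    and 3: "\<And>x W. (\<And>s z. (s, z) \<in> W \<Longrightarrow> (x, z, s) \<in> fluid_domain zb H I) \<Longrightarrow>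
       partials_on W (\<lambda>s z. f x z s) (\<lambda>s z. ft x z s) (\<lambda>s z. fz x z s)"
  show thesis
    by (rule that[OF 1 2 3]) (auto simp: fluid_domain_def band_def tband_def face_N)
qed

abbreviation avg where "avg \<equiv> layer_int l zb H"

text \<open>The second conclusion is the Leibniz rule solved for the integral of the derivative. As
  a \<open>has_integral\<close> fact it can be added term by term when a local equation is
  integrated over a layer.\<close>

lemma avg_dx:
  assumes t: "t \<in> I" and \<alpha>: "\<alpha> \<in> {1..N}"
    and f: "partials_on (band t) (\<lambda>y z. f y z t) fx fz"
  shows "((\<lambda>y. avg f \<alpha> y t) has_real_derivative dx (avg f \<alpha>) x t) (at x)"
    and "(fx x has_integral dx (avg f \<alpha>) x t - f x (face \<alpha> x t) t * face_x \<alpha> x t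
      + f x (face (\<alpha> - 1) x t) t * face_x (\<alpha> - 1) x t) {face (\<alpha> - 1) x t..face \<alpha> x t}"
proof -
  have D: "((\<lambda>y. avg f \<alpha> y t) has_real_derivative f x (face \<alpha> x t) t * face_x \<alpha> x t
      - f x (face (\<alpha> - 1) x t) t * face_x (\<alpha> - 1) x t
      + integral {face (\<alpha> - 1) x t..face \<alpha> x t} (fx x)) (at x)"
    unfolding layer_int_def by (rule leibniz_face_dx[OF t _ _ f]) (use \<alpha> in auto)
  note eq = DERIV_imp_deriv[OF D, folded dx_def]
  show "((\<lambda>y. avg f \<alpha> y t) has_real_derivative dx (avg f \<alpha>) x t) (at x)"
    using D eq by simp
  have "continuous_on (band t) (\<lambda>(y, z). fx y z)" using f unfolding partials_on_def by blast
  hence "continuous_on {face (\<alpha> - 1) x t..face \<alpha> x t} (fx x)"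
    by (intro continuous_on_layers[OF _ _ t]) (use \<alpha> in auto)
  thus "(fx x has_integral dx (avg f \<alpha>) x t - f x (face \<alpha> x t) t * face_x \<alpha> x t
      + f x (face (\<alpha> - 1) x t) t * face_x (\<alpha> - 1) x t) {face (\<alpha> - 1) x t..face \<alpha> x t}"
    unfolding has_integral_iff eq by (auto intro: integrable_continuous_real)
qed

lemma avg_dt:
  assumes t: "t \<in> I" and \<alpha>: "\<alpha> \<in> {1..N}"
    and f: "partials_on (tband x) (\<lambda>s z. f x z s) fs fz"
  shows "(fs t has_integral dt (avg f \<alpha>) x t - f x (face \<alpha> x t) t * face_t \<alpha> x t
      + f x (face (\<alpha> - 1) x t) t * face_t (\<alpha> - 1) x t) {face (\<alpha> - 1) x t..face \<alpha> x t}"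
proof -
  have D: "((\<lambda>s. avg f \<alpha> x s) has_real_derivative f x (face \<alpha> x t) t * face_t \<alpha> x t
      - f x (face (\<alpha> - 1) x t) t * face_t (\<alpha> - 1) x t
      + integral {face (\<alpha> - 1) x t..face \<alpha> x t} (fs t)) (at t)"
    unfolding layer_int_def by (rule leibniz_face_dt[OF t _ _ f]) (use \<alpha> in auto)
  have "continuous_on (tband x) (\<lambda>(s, z). fs s z)" using f unfolding partials_on_def by blast
  hence "continuous_on {face (\<alpha> - 1) x t..face \<alpha> x t} (fs t)"
    by (rule continuous_on_curve)
      (use \<alpha> between_faces_in_band(2)[of "\<alpha> - 1" \<alpha>, OF _ _ t] in \<open>auto intro!: continuous_intros\<close>)
  thus ?thesis
    unfolding has_integral_iff dt_def DERIV_imp_deriv[OF D] by (auto intro: integrable_continuous_real)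
qed

lemma face_range_has_integral_dz:
  assumes t: "t \<in> I" and ab: "\<alpha> \<le> \<beta>" "\<beta> \<le> N"
    and f: "partials_on (band t) f fx fz"
  shows "(fz x has_integral f x (face \<beta> x t) - f x (face \<alpha> x t)) {face \<alpha> x t..face \<beta> x t}"
proof (rule fundamental_theorem_of_calculus)
  show "face \<alpha> x t \<le> face \<beta> x t" by (rule face_mono[OF ab t])
  fix z assume "z \<in> {face \<alpha> x t..face \<beta> x t}"
  hence "(x, z) \<in> band t" using between_faces_in_band(1)[OF _ _ t, of \<alpha> \<beta>] ab by auto
  from partials_on_snd[OF f this]
  show "(f x has_vector_derivative fz x z) (at z within {face \<alpha> x t..face \<beta> x t})"
    by (auto simp: has_real_derivative_iff_has_vector_derivative intro: has_vector_derivative_at_within)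
qed

text \<open>Merging the layers before differentiating leaves a single integral, so traces arise only
  at its two outer interfaces.\<close>

lemma sum_avg_dx:
  assumes t: "t \<in> I" and ab: "\<alpha> \<le> \<beta>" "\<beta> \<le> N"
    and f: "partials_on (band t) (\<lambda>y z. f y z t) fx fz"
  shows "dx (\<lambda>x t. \<Sum>j=\<alpha>+1..\<beta>. avg f j x t) x t =
    deriv (\<lambda>y. integral {face \<alpha> y t..face \<beta> y t} (\<lambda>z. f y z t)) x"
  unfolding dx_def layer_int_def
  by (rule arg_cong[of _ _ "\<lambda>h. deriv h x"], rule ext)
    (rule sum_layers[OF t ab(2) partials_on_continuous[OF f] ab(1)])

lemma dt_sum_layer_h:
  assumes "t \<in> I"
  shows "dt (\<lambda>x t. \<Sum>j=1..\<alpha>. layer_h l H j x t) x t = face_t \<alpha> x t"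
  unfolding dt_def layer_h_def sum_distrib_right[symmetric] face_t_def frac_def
  by (rule DERIV_imp_deriv) (auto intro!: derivative_eq_intros H_derivs(3) assms simp: dt_def)

lemma dx_eta:
  assumes "t \<in> I"
  shows "dx (\<lambda>x t. zb x + H x t) x t = face_x N x t"
  using dx_face[OF assms, of N x] unfolding dx_def face_N .

lemma dt_eta:
  assumes "t \<in> I"
  shows "dt (\<lambda>x t. zb x + H x t) x t = face_t N x t"
  using DERIV_imp_deriv[OF face_has_dt[OF assms, of N x]] unfolding dt_def face_N .

section \<open>Stress conditions at the surface and at the bottom\<close>

lemma sigma_of_face:
  assumes "t \<in> I"
  shows "sigma_of l zb H \<alpha> s x t = s X Z - face_x \<alpha> x t * (s X X + face_x \<alpha> x t * s Z X - s Z Z)"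
  unfolding sigma_of_def dx_face[OF assms] ..

lemma c_face_eq: "t \<in> I \<Longrightarrow> c_face l zb H \<alpha> x t = 1 / sqrt (1 + (face_x \<alpha> x t)\<^sup>2)"
  unfolding c_face_def by (simp add: dx_face)

text \<open>The vertical component of the zero traction expresses the pressure through
  \<open>S Z Z\<close> and \<open>S Z X\<close>; inserting this in the horizontal component gives
  the vanishing of \<open>\<sigma>\<close>.\<close>

lemma surface_stress:
  assumes t: "t \<in> I"
    and "traction p S x (zb x + H x t) t (upward_normal (face_x N x t)) = 0"
  shows "sigma_of l zb H N (\<lambda>a b. S a b x (face N x t) t) x t = 0"
proof -
  let ?s = "face_x N x t" and ?z = "zb x + H x t"
  have "sqrt (1 + ?s\<^sup>2) \<noteq> 0" by (simp add: add_nonneg_eq_0_iff)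
  then obtain q where q: "upward_normal ?s = (- ?s * q, q)" "q \<noteq> 0"
    by (intro that[of "1 / sqrt (1 + ?s\<^sup>2)"]) (simp_all add: upward_normal_def)
  have "q * (S X Z x ?z t - ?s * (S X X x ?z t - p x ?z t)) = 0"
      "q * (S Z Z x ?z t - p x ?z t - ?s * S Z X x ?z t) = 0"
    using assms(2) unfolding q(1) by (simp_all add: traction_def zero_prod_def algebra_simps)
  hence "S X Z x ?z t = ?s * (S X X x ?z t - p x ?z t)" "S Z Z x ?z t - p x ?z t = ?s * S Z X x ?z t"
    using q(2) by simp_all
  thus ?thesis unfolding sigma_of_face[OF t] face_N by (simp add: algebra_simps)
qed

text \<open>Testing the wall law against the tangent \<open>(1, z\<^sub>b')\<close> eliminates the pressure.\<close>

lemma bottom_stress: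
  assumes t: "t \<in> I" and imp: "ub * deriv zb x - wb = 0"
    and F: "F = traction p S x (zb x) t nb" and nb: "nb = upward_normal (deriv zb x)"
    and wall: "F - (nb \<bullet> F) *\<^sub>R nb = k *\<^sub>R (ub, wb)"
  shows "(c_face l zb H 0 x t)\<^sup>2 * sigma_of l zb H 0 (\<lambda>a b. S a b x (zb x) t) x t
    = k / c_face l zb H 0 x t * ub"
proof -
  define s where "s = deriv zb x"
  define r where "r = sqrt (1 + s\<^sup>2)"
  have r: "r > 0" "r\<^sup>2 = 1 + s\<^sup>2"
    unfolding r_def by (auto intro: add_pos_nonneg simp: add_nonneg_nonneg)
  have fx: "face_x 0 x t = s" by (simp add: face_x_def s_def)
  have c: "c_face l zb H 0 x t = 1 / r" by (simp add: c_face_eq[OF t] fx r_def)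
  have n: "fst nb = - s / r" "snd nb = 1 / r" by (simp_all add: nb upward_normal_def r_def s_def)
  have "fst F - (nb \<bullet> F) * fst nb = k * ub" "snd F - (nb \<bullet> F) * snd nb = k * wb"
    using arg_cong[OF wall, of fst] arg_cong[OF wall, of snd] by simp_all
  \<comment> \<open>The product with the tangent (1, s), whose factor multiplying
    \<open>nb \<bullet> F\<close> vanishes by orthogonality.\<close>
  hence "fst F + s * snd F - (nb \<bullet> F) * (fst nb + s * snd nb) = k * (ub + s * wb)"
    by (simp add: algebra_simps)
  moreover have "fst nb + s * snd nb = 0" by (simp add: n)
  \<comment> \<open>Impermeability gives \<open>wb = s * ub\<close>, which is the origin of one
    factor \<open>1 + s\<^sup>2\<close>.\<close>
  moreover have "ub + s * wb = ub * r\<^sup>2"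
    using imp r(2) by (simp add: s_def[symmetric] power2_eq_square algebra_simps)
  ultimately have "fst F + s * snd F = k * ub * r\<^sup>2" by (simp add: mult.assoc)
  \<comment> \<open>The two pressure contributions, \<open>s * p / r\<close> and its negative,
    cancel here.\<close>
  moreover have "fst F + s * snd F = sigma_of l zb H 0 (\<lambda>a b. S a b x (zb x) t) x t / r"
    unfolding F traction_def sigma_of_face[OF t] fx fst_conv snd_conv n using r(1)
    by (simp add: field_simps)
  ultimately have "sigma_of l zb H 0 (\<lambda>a b. S a b x (zb x) t) x t = k * ub * r\<^sup>2 * r"
    using r(1) by (simp add: field_simps)
  thus ?thesis unfolding c using r(1) by (simp add: field_simps power2_eq_square)
qed

section \<open>Exact integration of the equations over a layer\<close>

lemma exact_averaged_equations:
  assumes NS: "hydrostatic_NS g zb kappa I H u w p S"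
  shows "averaged_equations N l g zb kappa H I (exact_averages l zb H u w S)"
proof -
  let ?D = "fluid_domain zb H I"
  have sm: "smooth_on ?D (\<lambda>(x, z, t). u x z t)" "smooth_on ?D (\<lambda>(x, z, t). w x z t)"
      "\<And>a b. smooth_on ?D (\<lambda>(x, z, t). S a b x z t)"
    and eqs: "\<And>x z t. t \<in> I \<Longrightarrow> zb x < z \<Longrightarrow> z < face N x t \<Longrightarrow> pdx u x z t + pdz w x z t = 0"
      "\<And>x z t. t \<in> I \<Longrightarrow> zb x < z \<Longrightarrow> z < face N x t \<Longrightarrow>
        pdt u x z t + pdx (\<lambda>x z t. (u x z t)\<^sup>2) x z t + pdz (\<lambda>x z t. u x z t * w x z t) x z t
              + g * dx (\<lambda>x t. zb x + H x t) x t
            = pdx (S X X) x z t + pdz (S X Z) x z t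
              + pdx (pdx (\<lambda>x z t. integral {z..face N x t} (\<lambda>r. S Z X x r t))) x z t
              - pdx (S Z Z) x z t"
    and bc: "\<And>x t. t \<in> I \<Longrightarrow> dt (\<lambda>x t. zb x + H x t) x t
          + u x (zb x + H x t) t * dx (\<lambda>x t. zb x + H x t) x t - w x (zb x + H x t) t = 0"
      "\<And>x t. t \<in> I \<Longrightarrow> traction p S x (zb x + H x t) t (upward_normal (dx (\<lambda>x t. zb x + H x t) x t)) = 0"
      "\<And>x t. t \<in> I \<Longrightarrow> u x (zb x) t * deriv zb x - w x (zb x) t = 0"
    and wall: "\<And>x t. t \<in> I \<Longrightarrow> (let nb = upward_normal (deriv zb x); F = traction p S x (zb x) t nb
          in F - (nb \<bullet> F) *\<^sub>R nb = kappa (u x (zb x) t, w x (zb x) t) (H x t) *\<^sub>R (u x (zb x) t, w x (zb x) t))"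
    using NS unfolding hydrostatic_NS_def Let_def face_N by blast+
  obtain ux uz ut where
      u1: "\<And>t. t \<in> I \<Longrightarrow> partials_on (band t) (\<lambda>y z. u y z t) (\<lambda>y z. ux y z t) (\<lambda>y z. uz y z t)"
    and u2: "\<And>x. partials_on (tband x) (\<lambda>s z. u x z s) (\<lambda>s z. ut x z s) (\<lambda>s z. uz x z s)"
    by (rule fluid_partials[OF sm(1)]) (rule that; assumption)
  obtain wx wz where
      w1: "\<And>t. t \<in> I \<Longrightarrow> partials_on (band t) (\<lambda>y z. w y z t) (\<lambda>y z. wx y z t) (\<lambda>y z. wz y z t)"
    by (rule fluid_partials[OF sm(2)]) (rule that; assumption)
  obtain Sxxx Sxxz where
      Sxx: "\<And>t. t \<in> I \<Longrightarrow> partials_on (band t) (\<lambda>y z. S X X y z t) (\<lambda>y z. Sxxx y z t) (\<lambda>y z. Sxxz y z t)"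
    by (rule fluid_partials[OF sm(3)]) (rule that; assumption)
  obtain Sxzx Sxzz where
      Sxz: "\<And>t. t \<in> I \<Longrightarrow> partials_on (band t) (\<lambda>y z. S X Z y z t) (\<lambda>y z. Sxzx y z t) (\<lambda>y z. Sxzz y z t)"
    by (rule fluid_partials[OF sm(3)]) (rule that; assumption)
  obtain Szzx Szzz where
      Szz: "\<And>t. t \<in> I \<Longrightarrow> partials_on (band t) (\<lambda>y z. S Z Z y z t) (\<lambda>y z. Szzx y z t) (\<lambda>y z. Szzz y z t)"
    by (rule fluid_partials[OF sm(3)]) (rule that; assumption)
  \<comment> \<open>The non-local term takes two x-derivatives of \<open>S Z X\<close>; smoothness
    of the first partial derivative is kept in order to differentiate it once more.\<close>
  obtain Szxx Szxz where sm_Szxx: "smooth_on ?D (\<lambda>(x, z, t). Szxx x z t)"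
    and Szx: "\<And>t. t \<in> I \<Longrightarrow> partials_on (band t) (\<lambda>y z. S Z X y z t) (\<lambda>y z. Szxx y z t) (\<lambda>y z. Szxz y z t)"
    by (rule fluid_partials[OF sm(3)]) (rule that; assumption)
  obtain Szxxx Szxxz where
      Szxx: "\<And>t. t \<in> I \<Longrightarrow> partials_on (band t) (\<lambda>y z. Szxx y z t) (\<lambda>y z. Szxxx y z t) (\<lambda>y z. Szxxz y z t)"
    by (rule fluid_partials[OF sm_Szxx]) (rule that; assumption)
  have uu: "partials_on (band t) (\<lambda>y z. (u y z t)\<^sup>2) (\<lambda>y z. 2 * u y z t * ux y z t) (\<lambda>y z. 2 * u y z t * uz y z t)"
    if "t \<in> I" for t
    using partials_on_mult[OF u1[OF that] u1[OF that]] by (simp add: power2_eq_square mult_ac)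
  have uw: "partials_on (band t) (\<lambda>y z. u y z t * w y z t) (\<lambda>y z. ux y z t * w y z t + u y z t * wx y z t)
      (\<lambda>y z. uz y z t * w y z t + u y z t * wz y z t)" if "t \<in> I" for t
    by (rule partials_on_mult[OF u1[OF that] w1[OF that]])
  have zu: "partials_on (band t) (\<lambda>y z. z * u y z t) (\<lambda>y z. z * ux y z t) (\<lambda>y z. u y z t + z * uz y z t)"
    if "t \<in> I" for t
    using partials_on_mult[OF partials_on_proj_snd u1[OF that]] by simp
  have zw: "partials_on (band t) (\<lambda>y z. z * w y z t) (\<lambda>y z. z * wx y z t) (\<lambda>y z. w y z t + z * wz y z t)"
    if "t \<in> I" for t
    using partials_on_mult[OF partials_on_proj_snd w1[OF that]] by simp
  have zS: "partials_on (band t) (\<lambda>y z. z * S Z X y z t) (\<lambda>y z. z * Szxx y z t) (\<lambda>y z. S Z X y z t + z * Szxz y z t)"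
    "partials_on (band t) (\<lambda>y z. z * Szxx y z t) (\<lambda>y z. z * Szxxx y z t) (\<lambda>y z. Szxx y z t + z * Szxxz y z t)"
    if "t \<in> I" for t
    using partials_on_mult[OF partials_on_proj_snd Szx[OF that]]
      partials_on_mult[OF partials_on_proj_snd Szxx[OF that]] by simp_all
  have in_band: "(x, z) \<in> band t" "(t, z) \<in> tband x" if "t \<in> I" "zb x < z" "z < face N x t" for x z t
    using that by (auto simp: band_def tband_def)
  have div: "ux x z t = - wz x z t" if "t \<in> I" "zb x < z" "z < face N x t" for x z t
    using eqs(1)[OF that] unfolding pdx_def pdz_def
      DERIV_imp_deriv[OF partials_on_fst[OF u1[OF that(1)] in_band(1)[OF that]]]
      DERIV_imp_deriv[OF partials_on_snd[OF w1[OF that(1)] in_band(1)[OF that]]] by simp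
  have mom: "ut x z t + 2 * u x z t * ux x z t + (uz x z t * w x z t + u x z t * wz x z t) + g * face_x N x t
      = Sxxx x z t + Sxzz x z t
        + deriv (\<lambda>y. deriv (\<lambda>y. integral {z..face N y t} (\<lambda>r. S Z X y r t)) y) x - Szzx x z t"
    if "t \<in> I" "zb x < z" "z < face N x t" for x z t
  proof -
    note b = in_band(1)[OF that]
    show ?thesis
      using eqs(2)[OF that] unfolding pdx_def pdz_def pdt_def dx_eta[OF that(1)]
        DERIV_imp_deriv[OF partials_on_fst[OF u2 in_band(2)[OF that]]]
        DERIV_imp_deriv[OF partials_on_fst[OF uu[OF that(1)] b]]
        DERIV_imp_deriv[OF partials_on_snd[OF uw[OF that(1)] b]]
        DERIV_imp_deriv[OF partials_on_fst[OF Sxx[OF that(1)] b]]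
        DERIV_imp_deriv[OF partials_on_snd[OF Sxz[OF that(1)] b]]
        DERIV_imp_deriv[OF partials_on_fst[OF Szz[OF that(1)] b]] .
  qed
  have interior: "zb x < z" "z < face N x t"
    if "t \<in> I" "\<alpha> \<le> N" "\<beta> \<le> N" "face \<alpha> x t < z" "z < face \<beta> x t" for \<alpha> \<beta> x z t
    using that face_mono[of 0 \<alpha> t x] face_mono[of \<beta> N t x] by auto
  \<comment> \<open>Incompressibility integrated from the bottom up to an interface. The traces at
    the bottom drop out by impermeability.\<close>
  have flux: "dx (\<lambda>x t. \<Sum>j=1..\<alpha>. avg u j x t) x t
      = u x (face \<alpha> x t) t * face_x \<alpha> x t - w x (face \<alpha> x t) t" if t: "t \<in> I" and \<alpha>: "\<alpha> \<le> N" for \<alpha> x t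
  proof -
    have "((\<lambda>z. - wz x z t) has_integral - (w x (face \<alpha> x t) t - w x (face 0 x t) t)) {face 0 x t..face \<alpha> x t}"
      by (rule has_integral_neg[OF face_range_has_integral_dz[OF t le0 \<alpha> w1[OF t]]])
    hence "((\<lambda>z. ux x z t) has_integral - (w x (face \<alpha> x t) t - w x (face 0 x t) t)) {face 0 x t..face \<alpha> x t}"
      by (rule has_integral_spike_interior[of _ _ "face 0 x t" "face \<alpha> x t", unfolded cbox_interval box_real])
        (use div[OF t] interior[OF t le0 \<alpha>] in auto)
    from integral_unique[OF this] show ?thesis
      using sum_avg_dx[where f = u, OF t le0 \<alpha> u1[OF t], of x] DERIV_imp_deriv[OF leibniz_face_dx[OF t le0 \<alpha> u1[OF t], of x]]
        bc(3)[OF t, of x] by (simp add: face_x_def)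
  qed
  have kinematic: "face_t N x t + u x (face N x t) t * face_x N x t - w x (face N x t) t = 0" if "t \<in> I" for x t
    using bc(1)[OF that, of x] unfolding dx_eta[OF that] dt_eta[OF that] face_N .
  \<comment> \<open>At the bottom and the surface \<open>exchange\<close> is zero by definition, and
    the kinematic conditions say that the right-hand side vanishes there too; so one formula is
    available for all interfaces.\<close>
  have exch: "exchange N l H (avg u) \<alpha> x t
      = face_t \<alpha> x t + u x (face \<alpha> x t) t * face_x \<alpha> x t - w x (face \<alpha> x t) t"
    if "t \<in> I" "\<alpha> \<le> N" for \<alpha> x t
  proof (cases "\<alpha> = 0 \<or> \<alpha> = N")
    case True
    thus ?thesis
      using kinematic[OF that(1), of x] bc(3)[OF that(1), of x]
      by (auto simp: exchange_def face_t_def face_x_def)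
  next
    case False
    thus ?thesis
      unfolding exchange_def dt_sum_layer_h[OF that(1)] flux[OF that] by simp
  qed
  show ?thesis
    unfolding averaged_equations_def
  proof (intro allI ballI conjI)
    fix x t assume t: "t \<in> I"
    show "dt (\<lambda>x t. \<Sum>j=1..N. layer_h l H j x t) x t
        + dx (\<lambda>x t. \<Sum>j=1..N. int_u (exact_averages l zb H u w S) j x t) x t = 0"
      using kinematic[OF t, of x] flux[OF t order_refl, of x] dt_sum_layer_h[OF t, of N x]
      by (simp add: exact_averages_def)
  next
    fix x t \<alpha> assume t: "t \<in> I" and \<alpha>: "\<alpha> \<in> {1..N}"
    let ?a = "face (\<alpha> - 1) x t" and ?b = "face \<alpha> x t"
    have le: "\<alpha> - 1 \<le> \<alpha>" "\<alpha> \<le> N" "\<alpha> - 1 \<le> N" using \<alpha> by auto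
    have range: "{\<alpha>..N} = {\<alpha> - 1 + 1..N}" using \<alpha> by simp
    have ab: "?a \<le> ?b" by (rule face_mono[OF le(1,2) t])
    show "dt (int_u (exact_averages l zb H u w S) \<alpha>) x t + dx (int_uu (exact_averages l zb H u w S) \<alpha>) x t
          + g * layer_h l H \<alpha> x t * dx (\<lambda>x t. zb x + H x t) x t
        = face_u (exact_averages l zb H u w S) \<alpha> x t * exchange N l H (int_u (exact_averages l zb H u w S)) \<alpha> x t
          - face_u (exact_averages l zb H u w S) (\<alpha> - 1) x t
              * exchange N l H (int_u (exact_averages l zb H u w S)) (\<alpha> - 1) x t
          + dx (\<lambda>x t. int_S (exact_averages l zb H u w S) X X \<alpha> x t - int_S (exact_averages l zb H u w S) Z Z \<alpha> x t
              + dx (int_zS (exact_averages l zb H u w S) Z X \<alpha>) x t) x t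
          + face \<alpha> x t * dx (dx (\<lambda>x t. \<Sum>j=\<alpha>+1..N. int_S (exact_averages l zb H u w S) Z X j x t)) x t
          - face (\<alpha> - 1) x t * dx (dx (\<lambda>x t. \<Sum>j=\<alpha>..N. int_S (exact_averages l zb H u w S) Z X j x t)) x t
          + face_sigma (exact_averages l zb H u w S) \<alpha> x t - face_sigma (exact_averages l zb H u w S) (\<alpha> - 1) x t"
    proof -
      define A2 where "A2 = deriv (\<lambda>y. deriv (\<lambda>y. integral {face (\<alpha> - 1) y t..face \<alpha> y t} (\<lambda>z. z * S Z X y z t)) y) x"
      define R1 where "R1 = deriv (\<lambda>y. deriv (\<lambda>y. integral {face \<alpha> y t..face N y t} (\<lambda>z. S Z X y z t)) y) x"
      define R0 where "R0 = deriv (\<lambda>y. deriv (\<lambda>y. integral {face (\<alpha> - 1) y t..face N y t} (\<lambda>z. S Z X y z t)) y) x"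
      have lhs: "((\<lambda>z. ut x z t + 2 * u x z t * ux x z t + (uz x z t * w x z t + u x z t * wz x z t) + g * face_x N x t)
          has_integral (dt (avg u \<alpha>) x t - u x ?b t * face_t \<alpha> x t + u x ?a t * face_t (\<alpha> - 1) x t)
          + (dx (avg (\<lambda>x z t. (u x z t)\<^sup>2) \<alpha>) x t - (u x ?b t)\<^sup>2 * face_x \<alpha> x t + (u x ?a t)\<^sup>2 * face_x (\<alpha> - 1) x t)
          + (u x ?b t * w x ?b t - u x ?a t * w x ?a t) + (?b - ?a) * (g * face_x N x t)) {?a..?b}"
        using has_integral_add[OF has_integral_add[OF has_integral_add[OF avg_dt[where f = u, OF t \<alpha> u2] avg_dx(2)[where f = "\<lambda>x z t. (u x z t)\<^sup>2", OF t \<alpha> uu[OF t]]]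
            face_range_has_integral_dz[OF t le(1,2) uw[OF t]]] has_integral_const_real[of "g * face_x N x t" ?a ?b]] ab
        by simp
      have rhs: "((\<lambda>z. Sxxx x z t + Sxzz x z t
            + deriv (\<lambda>y. deriv (\<lambda>y. integral {z..face N y t} (\<lambda>r. S Z X y r t)) y) x - Szzx x z t) has_integral
          (dx (avg (S X X) \<alpha>) x t - S X X x ?b t * face_x \<alpha> x t + S X X x ?a t * face_x (\<alpha> - 1) x t)
          + (S X Z x ?b t - S X Z x ?a t)
          + (A2 + ?b * R1 - ?a * R0 - (face_x \<alpha> x t)\<^sup>2 * S Z X x ?b t + (face_x (\<alpha> - 1) x t)\<^sup>2 * S Z X x ?a t)
          - (dx (avg (S Z Z) \<alpha>) x t - S Z Z x ?b t * face_x \<alpha> x t + S Z Z x ?a t * face_x (\<alpha> - 1) x t)) {?a..?b}"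
        unfolding A2_def R1_def R0_def
        by (rule has_integral_diff[OF has_integral_add[OF has_integral_add[OF avg_dx(2)[where f = "S X X", OF t \<alpha> Sxx[OF t]]
          face_range_has_integral_dz[OF t le(1,2) Sxz[OF t]]]
          height_integral_layer_average[OF t \<alpha> Szx[OF t] Szxx[OF t]]] avg_dx(2)[where f = "S Z Z", OF t \<alpha> Szz[OF t]]])
      have key: "(dt (avg u \<alpha>) x t - u x ?b t * face_t \<alpha> x t + u x ?a t * face_t (\<alpha> - 1) x t)
          + (dx (avg (\<lambda>x z t. (u x z t)\<^sup>2) \<alpha>) x t - (u x ?b t)\<^sup>2 * face_x \<alpha> x t + (u x ?a t)\<^sup>2 * face_x (\<alpha> - 1) x t)
          + (u x ?b t * w x ?b t - u x ?a t * w x ?a t) + (?b - ?a) * (g * face_x N x t)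
        = (dx (avg (S X X) \<alpha>) x t - S X X x ?b t * face_x \<alpha> x t + S X X x ?a t * face_x (\<alpha> - 1) x t)
          + (S X Z x ?b t - S X Z x ?a t)
          + (A2 + ?b * R1 - ?a * R0 - (face_x \<alpha> x t)\<^sup>2 * S Z X x ?b t + (face_x (\<alpha> - 1) x t)\<^sup>2 * S Z X x ?a t)
          - (dx (avg (S Z Z) \<alpha>) x t - S Z Z x ?b t * face_x \<alpha> x t + S Z Z x ?a t * face_x (\<alpha> - 1) x t)"
        (is "?L = ?R")
      proof -
        have "((\<lambda>z. ut x z t + 2 * u x z t * ux x z t + (uz x z t * w x z t + u x z t * wz x z t) + g * face_x N x t)
            has_integral ?R) {?a..?b}"
          by (rule has_integral_spike_interior[of _ _ ?a ?b, unfolded cbox_interval box_real, OF rhs])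
            (use mom[OF t] interior[OF t le(3,2)] in auto)
        thus ?thesis using lhs has_integral_unique by blast
      qed
      have zS_dx: "dx (\<lambda>x t. avg (S X X) \<alpha> x t - avg (S Z Z) \<alpha> x t + dx (avg (\<lambda>x z t. z * S Z X x z t) \<alpha>) x t) x t
          = dx (avg (S X X) \<alpha>) x t - dx (avg (S Z Z) \<alpha>) x t + A2"
      proof -
        have "((\<lambda>y. dx (avg (\<lambda>x z t. z * S Z X x z t) \<alpha>) y t) has_real_derivative A2) (at x)"
          using face_integral_has_dxx[OF t le(1,2) zS[OF t], of x]
            DERIV_imp_deriv[OF face_integral_has_dxx[OF t le(1,2) zS[OF t], of x]]
          unfolding A2_def dx_def layer_int_def by simp
        from DERIV_imp_deriv[OF DERIV_add[OF DERIV_diff[OF avg_dx(1)[where f = "S X X", OF t \<alpha> Sxx[OF t]] avg_dx(1)[where f = "S Z Z", OF t \<alpha> Szz[OF t]]] this]]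
        show ?thesis unfolding dx_def .
      qed
      have R: "dx (dx (\<lambda>x t. \<Sum>j=\<alpha>+1..N. avg (S Z X) j x t)) x t = R1"
        "dx (dx (\<lambda>x t. \<Sum>j=\<alpha>..N. avg (S Z X) j x t)) x t = R0"
        unfolding dx_def[of "dx _"] range sum_avg_dx[where f = "S Z X", OF t le(2) order_refl Szx[OF t]]
          sum_avg_dx[where f = "S Z X", OF t le(3) order_refl Szx[OF t]] R1_def R0_def by simp_all
      have hab: "?b - ?a = layer_h l H \<alpha> x t" using face_step[of \<alpha> x t] \<alpha> by simp
      \<comment> \<open>At each interface the traces of the time derivative, of
        \<open>u\<^sup>2\<close> and of \<open>u * w\<close> add up to \<open>u\<close> times the
        expression in \<open>exch\<close>. The traces of the stresses and the slope-squared surplus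
        add up to \<open>\<sigma>\<close>.\<close>
      show ?thesis
        using key unfolding hab exact_averages_def averages.simps zS_dx R exch[OF t le(2)] exch[OF t le(3)]
          dx_eta[OF t] sigma_of_face[OF t]
        by (simp add: power2_eq_square algebra_simps)
    qed
    show "int_w (exact_averages l zb H u w S) \<alpha> x t = dx (int_zu (exact_averages l zb H u w S) \<alpha>) x t
          - face \<alpha> x t * dx (\<lambda>x t. \<Sum>j=1..\<alpha>. int_u (exact_averages l zb H u w S) j x t) x t
          + face (\<alpha> - 1) x t * dx (\<lambda>x t. \<Sum>j=1..\<alpha>-1. int_u (exact_averages l zb H u w S) j x t) x t"
    proof -
      \<comment> \<open>The integrand is the z-derivative of \<open>z * w\<close> plus the
        x-derivative of \<open>z * u\<close>. Since \<open>ux = - wz\<close> inside the fluid it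
        equals \<open>w\<close> there, so the average of \<open>w\<close> is found without
        integrating \<open>w\<close> itself.\<close>
      have "((\<lambda>z. (w x z t + z * wz x z t) + z * ux x z t) has_integral (?b * w x ?b t - ?a * w x ?a t)
          + (dx (avg (\<lambda>x z t. z * u x z t) \<alpha>) x t - ?b * u x ?b t * face_x \<alpha> x t
             + ?a * u x ?a t * face_x (\<alpha> - 1) x t)) {?a..?b}"
        by (rule has_integral_add[OF face_range_has_integral_dz[OF t le(1,2) zw[OF t]] avg_dx(2)[where f = "\<lambda>x z t. z * u x z t", OF t \<alpha> zu[OF t]]])
      hence "((\<lambda>z. w x z t) has_integral (?b * w x ?b t - ?a * w x ?a t)
          + (dx (avg (\<lambda>x z t. z * u x z t) \<alpha>) x t - ?b * u x ?b t * face_x \<alpha> x t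
             + ?a * u x ?a t * face_x (\<alpha> - 1) x t)) {?a..?b}"
        by (rule has_integral_spike_interior[of _ _ ?a ?b, unfolded cbox_interval box_real])
          (use div[OF t] interior[OF t le(3,2)] in auto)
      from integral_unique[OF this, folded layer_int_def] show ?thesis
        by (simp add: exact_averages_def flux[OF t le(2), simplified] flux[OF t le(3), simplified] algebra_simps)
    qed
  next
    fix x t assume t: "t \<in> I"
    show "(c_face l zb H 0 x t)\<^sup>2 * face_sigma (exact_averages l zb H u w S) 0 x t
        = kappa (bed_velocity (exact_averages l zb H u w S) x t) (H x t) / c_face l zb H 0 x t
          * fst (bed_velocity (exact_averages l zb H u w S) x t)"
      using bottom_stress[OF t bc(3)[OF t] refl refl wall[OF t, unfolded Let_def]]
      by (simp add: exact_averages_def)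
    show "(c_face l zb H N x t)\<^sup>2 * face_sigma (exact_averages l zb H u w S) N x t = 0"
      using surface_stress[OF t bc(2)[OF t, unfolded dx_eta[OF t]]] by (simp add: exact_averages_def)
  qed
qed

section \<open>Closure and energy\<close>

abbreviation h where "h \<equiv> layer_h l H"
abbreviation zm where "zm \<equiv> z_mid l zb H"

lemma twice_dx_h:
  assumes "t \<in> I"
  shows "twice_dx t (h \<alpha>)" "dx (h \<alpha>) x t = l \<alpha> * dx H x t"
proof -
  have "((\<lambda>y. h \<alpha> y t) has_real_derivative l \<alpha> * dx H x t) (at x)"
    "((\<lambda>y. l \<alpha> * dx H y t) has_real_derivative l \<alpha> * dx (dx H) x t) (at x)" for x
    unfolding layer_h_def by (intro DERIV_cmult H_derivs(1,2) assms)+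
  note R = twice_dxI[where f = "h \<alpha>" and t = t, OF this]
  show "twice_dx t (h \<alpha>)" "dx (h \<alpha>) x t = l \<alpha> * dx H x t" by (rule R)+
qed

lemma twice_dx_zm:
  assumes "t \<in> I"
  shows "twice_dx t (zm \<alpha>)" "dx (zm \<alpha>) x t = (face_x \<alpha> x t + face_x (\<alpha> - 1) x t) / 2"
proof -
  have "((\<lambda>y. zm \<alpha> y t) has_real_derivative (face_x \<alpha> x t + face_x (\<alpha> - 1) x t) / 2) (at x)"
    "((\<lambda>y. (face_x \<alpha> y t + face_x (\<alpha> - 1) y t) / 2) has_real_derivative (face_xx \<alpha> x t + face_xx (\<alpha> - 1) x t) / 2) (at x)" for x
    unfolding z_mid_def by (intro DERIV_cdivide DERIV_add face_has_dx face_x_has_dx assms)+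
  note R = twice_dxI[where f = "zm \<alpha>" and t = t, OF this]
  show "twice_dx t (zm \<alpha>)" "dx (zm \<alpha>) x t = (face_x \<alpha> x t + face_x (\<alpha> - 1) x t) / 2" by (rule R)+
qed

lemma face_minus_face: "1 \<le> \<alpha> \<Longrightarrow> face \<alpha> x t = zm \<alpha> x t + h \<alpha> x t / 2"
    "1 \<le> \<alpha> \<Longrightarrow> face (\<alpha> - 1) x t = zm \<alpha> x t - h \<alpha> x t / 2"
  using face_step[of \<alpha> x t] by (simp_all add: z_mid_def field_simps)

lemma square_face_diff: "1 \<le> \<alpha> \<Longrightarrow> ((face \<alpha> x t)\<^sup>2 - (face (\<alpha> - 1) x t)\<^sup>2) / 2 = h \<alpha> x t * zm \<alpha> x t"
  unfolding face_minus_face by (simp add: power2_eq_square field_simps)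

lemma energy_eq:
  "1 \<le> \<alpha> \<Longrightarrow> energy l g zb H u \<alpha> x t = h \<alpha> x t * ((u \<alpha> x t)\<^sup>2 / 2 + g * zm \<alpha> x t)"
  using square_face_diff[of \<alpha> x t] by (simp add: energy_def algebra_simps)

text \<open>Once the closed expressions are inserted, the two systems differ only in the form of the
  pressure term, of the z-moment of the stress and of the vertical velocity equation; each
  difference is an identity or a division by a positive depth.\<close>

lemma closed_averaged_equations_iff:
  assumes u: "\<And>\<alpha>. \<alpha> \<in> {1..N} \<Longrightarrow> smooth_on (UNIV \<times> I) (\<lambda>(x, t). u \<alpha> x t)"
  shows "averaged_equations N l g zb kappa H I (closed_averages N l zb kappa H u w Sl Sf) \<longleftrightarrow>
    layer_averaged_system N l g zb kappa H I u w Sl Sf"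
proof -
  let ?A = "closed_averages N l zb kappa H u w Sl Sf"
  let ?q = "\<lambda>j x t. h j x t * u j x t"
  have q: "twice_dx t (?q j)" if "t \<in> I" "j \<in> {1..N}" for t j
    by (rule twice_dx_mult(1)[OF twice_dx_h(1)[OF that(1)] twice_dx_smooth[OF u[OF that(2)] that(1)]])
  have c: "c_face l zb H \<alpha> x t \<noteq> 0" if "t \<in> I" for \<alpha> x t
    by (simp add: c_face_eq[OF that] add_nonneg_eq_0_iff)
  have zS: "(\<lambda>x t. ((face \<alpha> x t)\<^sup>2 - (face (\<alpha> - 1) x t)\<^sup>2) / 2 * Sl Z X \<alpha> x t) = (\<lambda>x t. h \<alpha> x t * zm \<alpha> x t * Sl Z X \<alpha> x t)"
    if "\<alpha> \<in> {1..N}" for \<alpha>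
    using that by (intro ext arg_cong2[where f = "(*)"] square_face_diff refl) simp
  \<comment> \<open>With \<open>h \<alpha> = l \<alpha> * H\<close> the derivative of
    \<open>g / 2 * h \<alpha> * H\<close> is \<open>g * h \<alpha>\<close> times that of
    \<open>H\<close>; adding the bottom slope gives the slope of the free surface.\<close>
  have pressure: "dx (\<lambda>x t. h \<alpha> x t * (u \<alpha> x t)\<^sup>2 + g / 2 * h \<alpha> x t * H x t) x t + g * h \<alpha> x t * deriv zb x
      = dx (\<lambda>x t. h \<alpha> x t * (u \<alpha> x t)\<^sup>2) x t + g * h \<alpha> x t * dx (\<lambda>x t. zb x + H x t) x t"
    if t: "t \<in> I" and \<alpha>: "\<alpha> \<in> {1..N}" for \<alpha> x t
  proof -
    note U = twice_dx_smooth[OF u[OF \<alpha>] t] and h = twice_dx_h[OF t]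
    have d1: "((\<lambda>y. h \<alpha> y t * (u \<alpha> y t)\<^sup>2) has_real_derivative dx (\<lambda>x t. h \<alpha> x t * (u \<alpha> x t)\<^sup>2) x t) (at x)"
      using twice_dxD(1)[OF twice_dx_mult(1)[OF h(1) twice_dx_mult(1)[OF U U]]]
      by (simp add: power2_eq_square)
    have d2: "((\<lambda>y. g / 2 * h \<alpha> y t * H y t) has_real_derivative g * h \<alpha> x t * dx H x t) (at x)"
      unfolding layer_h_def by (rule derivative_eq_intros H_derivs(1)[OF t] refl | simp)+
    show ?thesis
      unfolding dx_eta[OF t] unfolding dx_def[of "\<lambda>x t. _ x t + _ x t"] DERIV_imp_deriv[OF DERIV_add[OF d1 d2]]
      by (simp add: face_x_def algebra_simps)
  qed
  \<comment> \<open>The interfaces lie at \<open>zm \<alpha>\<close> plus and minus half of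
    \<open>h \<alpha>\<close>, so all terms with undifferentiated \<open>zm \<alpha>\<close> cancel.
    What remains is \<open>h \<alpha>\<close> times the stated velocity, and
    \<open>h \<alpha>\<close> is positive.\<close>
  have vertical: "h \<alpha> x t * w \<alpha> x t = dx (\<lambda>x t. h \<alpha> x t * zm \<alpha> x t * u \<alpha> x t) x t
        - face \<alpha> x t * dx (\<lambda>x t. \<Sum>j=1..\<alpha>. ?q j x t) x t
        + face (\<alpha> - 1) x t * dx (\<lambda>x t. \<Sum>j=1..\<alpha>-1. ?q j x t) x t
      \<longleftrightarrow> w \<alpha> x t = - (1 / 2) * dx (?q \<alpha>) x t - (\<Sum>j=1..\<alpha>-1. dx (?q j) x t) + u \<alpha> x t * dx (zm \<alpha>) x t"
    if t: "t \<in> I" and \<alpha>: "\<alpha> \<in> {1..N}" for \<alpha> x t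
  proof -
    have "dx (\<lambda>x t. h \<alpha> x t * zm \<alpha> x t * u \<alpha> x t) x t = dx (\<lambda>x t. zm \<alpha> x t * ?q \<alpha> x t) x t"
      by (simp add: mult_ac)
    hence 1: "dx (\<lambda>x t. h \<alpha> x t * zm \<alpha> x t * u \<alpha> x t) x t = dx (zm \<alpha>) x t * ?q \<alpha> x t + zm \<alpha> x t * dx (?q \<alpha>) x t"
      unfolding twice_dx_mult(2)[OF twice_dx_zm(1)[OF t] q[OF t \<alpha>]] .
    have 2: "dx (\<lambda>x t. \<Sum>j=1..\<beta>. ?q j x t) x t = (\<Sum>j=1..\<beta>. dx (?q j) x t)" if "\<beta> \<le> N" for \<beta>
      by (rule twice_dx_sum(2)) (use q[OF t] that in auto)
    have 3: "(\<Sum>j=1..\<alpha>. dx (?q j) x t) = (\<Sum>j=1..\<alpha>-1. dx (?q j) x t) + dx (?q \<alpha>) x t"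
      using \<alpha> by (cases \<alpha>) auto
    have h: "h \<alpha> x t > 0" using l_pos[OF \<alpha>] H_pos[OF t] by (simp add: layer_h_def)
    have "\<alpha> \<le> N" "\<alpha> - 1 \<le> N" "1 \<le> \<alpha>" using \<alpha> by auto
    have "dx (\<lambda>x t. h \<alpha> x t * zm \<alpha> x t * u \<alpha> x t) x t
        - face \<alpha> x t * dx (\<lambda>x t. \<Sum>j=1..\<alpha>. ?q j x t) x t
        + face (\<alpha> - 1) x t * dx (\<lambda>x t. \<Sum>j=1..\<alpha>-1. ?q j x t) x t
        = h \<alpha> x t * (- (1 / 2) * dx (?q \<alpha>) x t - (\<Sum>j=1..\<alpha>-1. dx (?q j) x t) + u \<alpha> x t * dx (zm \<alpha>) x t)"
      unfolding 1 2[OF \<open>\<alpha> \<le> N\<close>] 2[OF \<open>\<alpha> - 1 \<le> N\<close>] 3 face_minus_face[OF \<open>1 \<le> \<alpha>\<close>] by (simp add: field_simps)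
    thus ?thesis using h by simp
  qed
  \<comment> \<open>\<open>closed_sigma\<close> at the two ends was defined by solving the stress
    conditions, so these hold identically and disappear from the equivalence.\<close>
  have friction: "(c_face l zb H 0 x t)\<^sup>2 * closed_sigma N l zb kappa H u Sf 0 x t
      = kappa (closed_bed_velocity zb u x t) (H x t) / c_face l zb H 0 x t * fst (closed_bed_velocity zb u x t)"
    "(c_face l zb H N x t)\<^sup>2 * closed_sigma N l zb kappa H u Sf N x t = 0" if "t \<in> I" for x t
    using c[OF that, of 0 x] N by (auto simp: closed_sigma_def closed_kappa_def closed_bed_velocity_def)
  show ?thesis
    unfolding averaged_equations_def layer_averaged_system_def closed_averages_def averages.simps
  proof (intro iff_allI ball_cong refl, goal_cases)
    case (1 x t)
    show ?case
      unfolding friction[OF 1] simp_thms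
    proof (intro arg_cong2[where f = "(\<and>)"] ball_cong refl, goal_cases)
      case (1 \<alpha>)
      show ?case
        using pressure[OF \<open>t \<in> I\<close> 1, of x] unfolding zS[OF 1] by linarith
    next
      case (2 \<alpha>)
      show ?case by (rule vertical[OF \<open>t \<in> I\<close> 2])
    qed
  qed
qed

section \<open>The energy balance of the layer-averaged system\<close>

lemma energy_balance:
  assumes u: "\<And>\<alpha>. \<alpha> \<in> {1..N} \<Longrightarrow> smooth_on (UNIV \<times> I) (\<lambda>(x, t). u \<alpha> x t)"
    and Sl: "\<And>a b \<alpha>. \<alpha> \<in> {1..N} \<Longrightarrow> smooth_on (UNIV \<times> I) (\<lambda>(x, t). Sl a b \<alpha> x t)"
    and sys: "layer_averaged_system N l g zb kappa H I u w Sl Sf" and t: "t \<in> I"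
  shows "dt (\<lambda>x t. \<Sum>\<alpha>=1..N. energy l g zb H u \<alpha> x t) x t + dx (energy_flux N l g zb H u w Sl) x t
    = energy_source N l zb kappa H u w Sl Sf x t + energy_correction N l g zb H u x t"
proof -
  define q where "q = (\<lambda>j x t. h j x t * u j x t)"
  define T where "T = (\<lambda>j x t. h j x t * Sl Z X j x t)"
  define R where "R = (\<lambda>\<alpha> x t. \<Sum>j=\<alpha>+1..N. T j x t)"
  define P where "P = (\<lambda>\<alpha> x t. h \<alpha> x t * Sl X X \<alpha> x t - h \<alpha> x t * Sl Z Z \<alpha> x t)"
  define Px where "Px = (\<lambda>\<alpha>. dx (\<lambda>x t. h \<alpha> x t * Sl X X \<alpha> x t) x t - dx (\<lambda>x t. h \<alpha> x t * Sl Z Z \<alpha> x t) x t)"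
  define G where "G = (\<lambda>\<alpha>. exchange N l H q \<alpha> x t)"
  define uf where "uf = (\<lambda>\<alpha>. upwind_u N l H u \<alpha> x t)"
  define \<sigma> where "\<sigma> = (\<lambda>\<alpha>. closed_sigma N l zb kappa H u Sf \<alpha> x t)"
  define Q where "Q = (\<lambda>\<alpha>. \<Sum>j=1..\<alpha>-1. dx (q j) x t)"
  define ut where "ut = (\<lambda>\<alpha>. dt (u \<alpha>) x t)"
  define ht where "ht = (\<lambda>\<alpha>. l \<alpha> * dt H x t)"
  note sys' = sys[unfolded layer_averaged_system_def, folded q_def T_def, rule_format, OF t]
  have mass: "dt (\<lambda>x t. \<Sum>j=1..N. h j x t) x t + dx (\<lambda>x t. \<Sum>j=1..N. q j x t) x t = 0" for x
    using sys'[of x] by (simp add: q_def)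
  have tu: "twice_dx t (u \<alpha>)" and tq: "twice_dx t (q \<alpha>)" and tT: "twice_dx t (T \<alpha>)"
    and tX: "twice_dx t (\<lambda>x t. h \<alpha> x t * Sl X X \<alpha> x t)" and tZ: "twice_dx t (\<lambda>x t. h \<alpha> x t * Sl Z Z \<alpha> x t)"
    if \<alpha>: "\<alpha> \<in> {1..N}" for \<alpha>
  proof -
    show tu: "twice_dx t (u \<alpha>)" by (rule twice_dx_smooth[OF u[OF \<alpha>] t])
    show "twice_dx t (q \<alpha>)" unfolding q_def by (rule twice_dx_mult(1)[OF twice_dx_h(1)[OF t] tu])
    show "twice_dx t (T \<alpha>)" "twice_dx t (\<lambda>x t. h \<alpha> x t * Sl X X \<alpha> x t)" "twice_dx t (\<lambda>x t. h \<alpha> x t * Sl Z Z \<alpha> x t)"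
      unfolding T_def by (rule twice_dx_mult(1)[OF twice_dx_h(1)[OF t] twice_dx_smooth[OF Sl[OF \<alpha>] t]])+
  qed
  have tR: "twice_dx t (R \<alpha>)" "dx (R \<alpha>) y t = (\<Sum>j=\<alpha>+1..N. dx (T j) y t)"
    "dx (dx (R \<alpha>)) y t = (\<Sum>j=\<alpha>+1..N. dx (dx (T j)) y t)" for \<alpha> y
    unfolding R_def by (rule twice_dx_sum; use tT in auto)+
  have qx: "dx (q \<alpha>) y t = dx (h \<alpha>) y t * u \<alpha> y t + h \<alpha> y t * dx (u \<alpha>) y t" if "\<alpha> \<in> {1..N}" for \<alpha> y
    unfolding q_def by (rule twice_dx_mult(2)[OF twice_dx_h(1)[OF t] tu[OF that]])
  have dP: "((\<lambda>y. P \<alpha> y t) has_real_derivative Px \<alpha>) (at x)" if "\<alpha> \<in> {1..N}" for \<alpha>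
    unfolding P_def Px_def by (rule DERIV_diff[OF twice_dxD(1)[OF tX[OF that]] twice_dxD(1)[OF tZ[OF that]]])
  \<comment> \<open>At the surface the left side is zero by definition and the right side by
    conservation of total mass; hence the formula holds at all interfaces and the difference of
    neighbours gives the mass balance of a single layer.\<close>
  have G_eq: "G \<alpha> = face_t \<alpha> x t + (\<Sum>j=1..\<alpha>. dx (q j) x t)" if "\<alpha> \<le> N" for \<alpha>
  proof -
    have s: "dx (\<lambda>x t. \<Sum>j=1..\<alpha>. q j x t) x t = (\<Sum>j=1..\<alpha>. dx (q j) x t)" if "\<alpha> \<le> N" for \<alpha>
      by (rule twice_dx_sum(2)) (use tq that in auto)
    have "dt (\<lambda>x t. \<Sum>j=1..\<alpha>. h j x t) x t + dx (\<lambda>x t. \<Sum>j=1..\<alpha>. q j x t) x t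
        = face_t \<alpha> x t + (\<Sum>j=1..\<alpha>. dx (q j) x t)"
      unfolding dt_sum_layer_h[OF t] s[OF that] ..
    thus ?thesis
      using mass[of x] unfolding G_def exchange_def by (cases "\<alpha> = 0") (auto simp: face_t_def)
  qed
  have G_diff: "G \<alpha> - G (\<alpha> - 1) = ht \<alpha> + dx (q \<alpha>) x t" if "\<alpha> \<in> {1..N}" for \<alpha>
  proof -
    have "\<alpha> \<le> N" "\<alpha> - 1 \<le> N" "1 \<le> \<alpha>" using that by auto
    moreover have "(\<Sum>j=1..\<alpha>. dx (q j) x t) = (\<Sum>j=1..\<alpha>-1. dx (q j) x t) + dx (q \<alpha>) x t"
      using that by (cases \<alpha>) auto
    ultimately show ?thesis
      by (simp add: G_eq face_t_def ht_def frac_step[of \<alpha>] algebra_simps del: sum.cl_ivl_Suc)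
  qed
  have G_ends: "G 0 = 0" "G N = 0" by (simp_all add: G_def exchange_def)
  have w: "w \<alpha> y t = - (1 / 2) * dx (q \<alpha>) y t - (\<Sum>j=1..\<alpha>-1. dx (q j) y t) + u \<alpha> y t * dx (zm \<alpha>) y t"
    if "\<alpha> \<in> {1..N}" for \<alpha> y
    using sys'[of y] that by (auto simp: q_def)
  \<comment> \<open>The closed formula expresses \<open>w \<alpha>\<close> through first derivatives
    of discharges and of \<open>zm \<alpha>\<close>, which are differentiable once more.\<close>
  have dw: "((\<lambda>y. w \<alpha> y t) has_real_derivative dx (w \<alpha>) x t) (at x)" if \<alpha>: "\<alpha> \<in> {1..N}" for \<alpha>
  proof -
    have "((\<lambda>y. \<Sum>j=1..\<alpha>-1. dx (q j) y t) has_real_derivative (\<Sum>j=1..\<alpha>-1. dx (dx (q j)) x t)) (at x)"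
      by (rule DERIV_sum, rule twice_dxD(2)[OF tq]) (use \<alpha> in auto)
    from DERIV_add[OF DERIV_diff[OF DERIV_cmult[OF twice_dxD(2)[OF tq[OF \<alpha>]], of "- (1 / 2)"] this]
      DERIV_mult[OF twice_dxD(1)[OF tu[OF \<alpha>]] twice_dxD(2)[OF twice_dx_zm(1)[OF t, of \<alpha>]]]]
    have "\<exists>D. ((\<lambda>y. w \<alpha> y t) has_real_derivative D) (at x)"
      unfolding w[OF \<alpha>] by (rule exI)
    then obtain D where D: "((\<lambda>y. w \<alpha> y t) has_real_derivative D) (at x)" ..
    show ?thesis unfolding dx_def DERIV_imp_deriv[OF D] by (rule D)
  qed
  \<comment> \<open>\<open>Kt\<close> is the rate of change of the kinetic energy of a layer,
    \<open>\<Phi>x\<close> the derivative of its energy flux, and \<open>g * Cx\<close> that of its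
    gravity correction.\<close>
  define Kt where "Kt = (\<lambda>\<alpha>. ht \<alpha> * (u \<alpha> x t)\<^sup>2 / 2 + h \<alpha> x t * u \<alpha> x t * ut \<alpha>)"
  define \<Phi>x where "\<Phi>x = (\<lambda>\<alpha>. dx (u \<alpha>) x t * (h \<alpha> x t * ((u \<alpha> x t)\<^sup>2 / 2 + g * zm \<alpha> x t) + g / 2 * h \<alpha> x t * H x t
        - P \<alpha> x t - (dx (zm \<alpha>) x t * T \<alpha> x t + h \<alpha> x t * (dx (T \<alpha>) x t / 2 + dx (R \<alpha>) x t)))
      + u \<alpha> x t * (dx (h \<alpha>) x t * ((u \<alpha> x t)\<^sup>2 / 2 + g * zm \<alpha> x t)
          + h \<alpha> x t * (u \<alpha> x t * dx (u \<alpha>) x t + g * dx (zm \<alpha>) x t)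
          + g / 2 * (dx (h \<alpha>) x t * H x t + h \<alpha> x t * dx H x t) - Px \<alpha>
          - (dx (dx (zm \<alpha>)) x t * T \<alpha> x t + dx (zm \<alpha>) x t * dx (T \<alpha>) x t
             + dx (h \<alpha>) x t * (dx (T \<alpha>) x t / 2 + dx (R \<alpha>) x t)
             + h \<alpha> x t * (dx (dx (T \<alpha>)) x t / 2 + dx (dx (R \<alpha>)) x t)))
      - (dx (w \<alpha>) x t * T \<alpha> x t + w \<alpha> x t * dx (T \<alpha>) x t))"
  define Cx where "Cx = (\<lambda>\<alpha>. dx (q \<alpha>) x t * (zm \<alpha> x t + H x t / 2 - (zb x + H x t))
      + h \<alpha> x t * u \<alpha> x t * (dx (zm \<alpha>) x t + dx H x t / 2 - (deriv zb x + dx H x t)))"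
  \<comment> \<open>The potential energy is differentiated as a difference of squared interface
    heights, because in this form its rates telescope over the layers.\<close>
  have energy_dt: "dt (\<lambda>x t. \<Sum>\<alpha>=1..N. energy l g zb H u \<alpha> x t) x t = (\<Sum>\<alpha>=1..N. Kt \<alpha>)
      + (\<Sum>\<alpha>=1..N. g * (face \<alpha> x t * face_t \<alpha> x t - face (\<alpha> - 1) x t * face_t (\<alpha> - 1) x t))"
  proof -
    have "((\<lambda>s. energy l g zb H u \<alpha> x s) has_real_derivative
        Kt \<alpha> + g * (face \<alpha> x t * face_t \<alpha> x t - face (\<alpha> - 1) x t * face_t (\<alpha> - 1) x t)) (at t)"
      if \<alpha>: "\<alpha> \<in> {1..N}" for \<alpha>
      unfolding energy_def layer_h_def
      by (rule derivative_eq_intros smooth_on_strip_dx(3)[OF u[OF \<alpha>] t] H_derivs(3)[OF t] face_has_dt[OF t] refl numeral_neq_zero)+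
        (simp add: Kt_def ht_def ut_def layer_h_def power2_eq_square field_simps)
    thus ?thesis
      unfolding dt_def sum.distrib[symmetric] by (intro deriv_sum)
  qed
  have flux_dx: "dx (energy_flux N l g zb H u w Sl) x t = (\<Sum>\<alpha>=1..N. \<Phi>x \<alpha>)"
  proof -
    have fn: "energy_flux N l g zb H u w Sl y t = (\<Sum>\<alpha>=1..N. u \<alpha> y t *
        (h \<alpha> y t * ((u \<alpha> y t)\<^sup>2 / 2 + g * zm \<alpha> y t) + g / 2 * h \<alpha> y t * H y t - P \<alpha> y t
          - (dx (zm \<alpha>) y t * T \<alpha> y t + h \<alpha> y t * (dx (T \<alpha>) y t / 2 + dx (R \<alpha>) y t))) - w \<alpha> y t * T \<alpha> y t)" for y
    proof -
      have "dx (\<lambda>x t. 1 / 2 * h \<alpha> x t * Sl Z X \<alpha> x t + (\<Sum>j=\<alpha>+1..N. h j x t * Sl Z X j x t)) y t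
          = dx (T \<alpha>) y t / 2 + dx (R \<alpha>) y t" if "\<alpha> \<in> {1..N}" for \<alpha>
      proof -
        have "dx (\<lambda>x t. 1 / 2 * T \<alpha> x t + R \<alpha> x t) y t = 1 / 2 * dx (T \<alpha>) y t + dx (R \<alpha>) y t"
          unfolding dx_def[of "\<lambda>x t. 1 / 2 * T \<alpha> x t + R \<alpha> x t"]
          by (rule DERIV_imp_deriv[OF DERIV_add[OF DERIV_cmult[OF twice_dxD(1)[OF tT[OF that]]] twice_dxD(1)[OF tR(1)]]])
        thus ?thesis by (simp add: T_def R_def mult.assoc)
      qed
      thus ?thesis
        unfolding energy_flux_def sum_subtractf[symmetric]
        by (intro sum.cong refl) (simp add: energy_eq T_def P_def algebra_simps)
    qed
    have "((\<lambda>y. u \<alpha> y t *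
        (h \<alpha> y t * ((u \<alpha> y t)\<^sup>2 / 2 + g * zm \<alpha> y t) + g / 2 * h \<alpha> y t * H y t - P \<alpha> y t
          - (dx (zm \<alpha>) y t * T \<alpha> y t + h \<alpha> y t * (dx (T \<alpha>) y t / 2 + dx (R \<alpha>) y t))) - w \<alpha> y t * T \<alpha> y t)
        has_real_derivative \<Phi>x \<alpha>) (at x)" if \<alpha>: "\<alpha> \<in> {1..N}" for \<alpha>
      by (rule derivative_eq_intros twice_dxD[OF tu[OF \<alpha>]] twice_dxD[OF tT[OF \<alpha>]] twice_dxD[OF tR(1)]
          twice_dxD[OF twice_dx_h(1)[OF t]] twice_dxD[OF twice_dx_zm(1)[OF t]] dP[OF \<alpha>] dw[OF \<alpha>] H_derivs(1)[OF t] refl numeral_neq_zero)+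
        (simp add: \<Phi>x_def power2_eq_square field_simps)
    thus ?thesis
      unfolding dx_def[of "energy_flux _ _ _ _ _ _ _ _"] fn by (intro deriv_sum)
  qed
  have corr_dx: "dx (\<lambda>x t. \<Sum>\<alpha>=1..N. g * h \<alpha> x t * u \<alpha> x t * (zm \<alpha> x t + H x t / 2 - (zb x + H x t))) x t
      = (\<Sum>\<alpha>=1..N. g * Cx \<alpha>)"
  proof -
    have "((\<lambda>y. g * h \<alpha> y t * u \<alpha> y t * (zm \<alpha> y t + H y t / 2 - (zb y + H y t))) has_real_derivative g * Cx \<alpha>) (at x)"
      if \<alpha>: "\<alpha> \<in> {1..N}" for \<alpha>
      by (rule derivative_eq_intros twice_dxD[OF tu[OF \<alpha>]] twice_dxD[OF twice_dx_h(1)[OF t]]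
          twice_dxD[OF twice_dx_zm(1)[OF t]] H_derivs(1)[OF t] zb_derivs(1) refl numeral_neq_zero)+
        (simp add: Cx_def qx[OF \<alpha>] field_simps)
    thus ?thesis
      unfolding dx_def[of "\<lambda>x t. \<Sum>\<alpha>=1..N. g * _ \<alpha> x t * _ \<alpha> x t * _ \<alpha> x t"] by (intro deriv_sum)
  qed
  have correction: "energy_correction N l g zb H u x t
      = (\<Sum>\<alpha>=1..N. g * Cx \<alpha>) - (\<Sum>\<alpha>=1..N-1. \<bar>G \<alpha>\<bar> / 2 * (u (\<alpha> + 1) x t - u \<alpha> x t)\<^sup>2)"
    unfolding energy_correction_def corr_dx G_def q_def ..
  have layer: "Kt \<alpha> + \<Phi>x \<alpha> + (dx (u \<alpha>) x t * P \<alpha> x t + (dx (w \<alpha>) x t + dx (zm \<alpha>) x t * dx (u \<alpha>) x t) * T \<alpha> x t)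
      - g * Cx \<alpha>
    = u \<alpha> x t * (uf \<alpha> * G \<alpha> - uf (\<alpha> - 1) * G (\<alpha> - 1)) - (u \<alpha> x t)\<^sup>2 / 2 * (G \<alpha> - G (\<alpha> - 1))
      + u \<alpha> x t * (\<sigma> \<alpha> - \<sigma> (\<alpha> - 1)) - (dx (q \<alpha>) x t * dx (R \<alpha>) x t - dx (T \<alpha>) x t * Q \<alpha>)
      + g * (zb x + H x t) * dx (q \<alpha>) x t" if \<alpha>: "\<alpha> \<in> {1..N}" for \<alpha>
    unfolding Kt_def \<Phi>x_def Cx_def G_diff[OF \<alpha>]
  proof (rule layer_energy_identity)
    show "w \<alpha> x t = - (1 / 2) * dx (q \<alpha>) x t - Q \<alpha> + u \<alpha> x t * dx (zm \<alpha>) x t"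
      using w[OF \<alpha>] by (simp add: Q_def)
    show "dx (q \<alpha>) x t = dx (h \<alpha>) x t * u \<alpha> x t + h \<alpha> x t * dx (u \<alpha>) x t" by (rule qx[OF \<alpha>])
    show "h \<alpha> x t = l \<alpha> * H x t" "dx (h \<alpha>) x t = l \<alpha> * dx H x t"
      by (simp_all add: twice_dx_h(2)[OF t] layer_h_def)
    have lhs_t: "dt (\<lambda>x t. h \<alpha> x t * u \<alpha> x t) x t = ht \<alpha> * u \<alpha> x t + h \<alpha> x t * ut \<alpha>"
    proof -
      have "((\<lambda>s. h \<alpha> x s * u \<alpha> x s) has_real_derivative ht \<alpha> * u \<alpha> x t + h \<alpha> x t * ut \<alpha>) (at t)"
        unfolding layer_h_def
        by (rule derivative_eq_intros smooth_on_strip_dx(3)[OF u[OF \<alpha>] t] H_derivs(3)[OF t] refl numeral_neq_zero)+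
          (simp add: ht_def ut_def)
      thus ?thesis unfolding dt_def[of "\<lambda>x t. h \<alpha> x t * u \<alpha> x t"] by (rule DERIV_imp_deriv)
    qed
    have lhs_x: "dx (\<lambda>x t. h \<alpha> x t * (u \<alpha> x t)\<^sup>2 + g / 2 * h \<alpha> x t * H x t) x t
        = dx (h \<alpha>) x t * (u \<alpha> x t)\<^sup>2 + 2 * h \<alpha> x t * u \<alpha> x t * dx (u \<alpha>) x t
          + g / 2 * (dx (h \<alpha>) x t * H x t + h \<alpha> x t * dx H x t)"
    proof -
      have "((\<lambda>y. h \<alpha> y t * (u \<alpha> y t)\<^sup>2 + g / 2 * h \<alpha> y t * H y t) has_real_derivative
          dx (h \<alpha>) x t * (u \<alpha> x t)\<^sup>2 + 2 * h \<alpha> x t * u \<alpha> x t * dx (u \<alpha>) x t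
          + g / 2 * (dx (h \<alpha>) x t * H x t + h \<alpha> x t * dx H x t)) (at x)"
        by (rule derivative_eq_intros twice_dxD[OF tu[OF \<alpha>]] twice_dxD[OF twice_dx_h(1)[OF t]] H_derivs(1)[OF t] refl numeral_neq_zero)+
          (simp add: power2_eq_square field_simps)
      thus ?thesis
        unfolding dx_def[of "\<lambda>x t. h \<alpha> x t * (u \<alpha> x t)\<^sup>2 + g / 2 * h \<alpha> x t * H x t"] by (rule DERIV_imp_deriv)
    qed
    have stress: "dx (\<lambda>x t. h \<alpha> x t * Sl X X \<alpha> x t - h \<alpha> x t * Sl Z Z \<alpha> x t
          + dx (\<lambda>x t. h \<alpha> x t * zm \<alpha> x t * Sl Z X \<alpha> x t) x t) x t
        = Px \<alpha> + dx (dx (zm \<alpha>)) x t * T \<alpha> x t + 2 * dx (zm \<alpha>) x t * dx (T \<alpha>) x t + zm \<alpha> x t * dx (dx (T \<alpha>)) x t"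
    proof -
      have e: "(\<lambda>x t. h \<alpha> x t * zm \<alpha> x t * Sl Z X \<alpha> x t) = (\<lambda>x t. zm \<alpha> x t * T \<alpha> x t)"
        by (simp add: T_def mult_ac)
      note m = twice_dx_mult[OF twice_dx_zm(1)[OF t] tT[OF \<alpha>]]
      have "((\<lambda>y. P \<alpha> y t + dx (\<lambda>x t. zm \<alpha> x t * T \<alpha> x t) y t) has_real_derivative
          Px \<alpha> + dx (dx (\<lambda>x t. zm \<alpha> x t * T \<alpha> x t)) x t) (at x)"
        by (rule DERIV_add[OF dP[OF \<alpha>] twice_dxD(2)[OF m(1)]])
      from DERIV_imp_deriv[OF this] show ?thesis
        unfolding e m(3) dx_def[of "\<lambda>x t. _ x t - _ x t + _ x t"] P_def by simp
    qed
    have R_eq: "dx (dx (\<lambda>x t. \<Sum>j=\<alpha>+1..N. h j x t * Sl Z X j x t)) x t = dx (dx (R \<alpha>)) x t"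
      "dx (dx (\<lambda>x t. \<Sum>j=\<alpha>..N. h j x t * Sl Z X j x t)) x t = dx (dx (T \<alpha>)) x t + dx (dx (R \<alpha>)) x t"
    proof -
      show "dx (dx (\<lambda>x t. \<Sum>j=\<alpha>+1..N. h j x t * Sl Z X j x t)) x t = dx (dx (R \<alpha>)) x t"
        by (simp add: R_def T_def)
      have "dx (dx (\<lambda>x t. \<Sum>j=\<alpha>..N. T j x t)) x t = (\<Sum>j=\<alpha>..N. dx (dx (T j)) x t)"
        by (rule twice_dx_sum(3)) (use tT \<alpha> in auto)
      also have "\<dots> = dx (dx (T \<alpha>)) x t + dx (dx (R \<alpha>)) x t"
        unfolding tR(3) using \<alpha> by (simp add: sum.atLeast_Suc_atMost)
      finally show "dx (dx (\<lambda>x t. \<Sum>j=\<alpha>..N. h j x t * Sl Z X j x t)) x t = dx (dx (T \<alpha>)) x t + dx (dx (R \<alpha>)) x t"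
        by (simp add: T_def)
    qed
    have "1 \<le> \<alpha>" using \<alpha> by simp
    have "dt (\<lambda>x t. h \<alpha> x t * u \<alpha> x t) x t + dx (\<lambda>x t. h \<alpha> x t * (u \<alpha> x t)\<^sup>2 + g / 2 * h \<alpha> x t * H x t) x t
        = - g * h \<alpha> x t * deriv zb x + uf \<alpha> * G \<alpha> - uf (\<alpha> - 1) * G (\<alpha> - 1)
          + dx (\<lambda>x t. h \<alpha> x t * Sl X X \<alpha> x t - h \<alpha> x t * Sl Z Z \<alpha> x t
                 + dx (\<lambda>x t. h \<alpha> x t * zm \<alpha> x t * Sl Z X \<alpha> x t) x t) x t
          + face \<alpha> x t * dx (dx (\<lambda>x t. \<Sum>j=\<alpha>+1..N. h j x t * Sl Z X j x t)) x t
          - face (\<alpha> - 1) x t * dx (dx (\<lambda>x t. \<Sum>j=\<alpha>..N. h j x t * Sl Z X j x t)) x t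
          + \<sigma> \<alpha> - \<sigma> (\<alpha> - 1)"
      using sys[unfolded layer_averaged_system_def, rule_format, OF t, of x] \<alpha>
      unfolding uf_def G_def \<sigma>_def q_def by blast
    thus "ht \<alpha> * u \<alpha> x t + h \<alpha> x t * ut \<alpha> + (dx (h \<alpha>) x t * (u \<alpha> x t)\<^sup>2 + 2 * h \<alpha> x t * u \<alpha> x t * dx (u \<alpha>) x t
          + g / 2 * (dx (h \<alpha>) x t * H x t + h \<alpha> x t * dx H x t))
        = - g * h \<alpha> x t * deriv zb x + (uf \<alpha> * G \<alpha> - uf (\<alpha> - 1) * G (\<alpha> - 1))
          + (Px \<alpha> + dx (dx (zm \<alpha>)) x t * T \<alpha> x t + 2 * dx (zm \<alpha>) x t * dx (T \<alpha>) x t + zm \<alpha> x t * dx (dx (T \<alpha>)) x t)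
          + (zm \<alpha> x t + h \<alpha> x t / 2) * dx (dx (R \<alpha>)) x t
          - (zm \<alpha> x t - h \<alpha> x t / 2) * (dx (dx (T \<alpha>)) x t + dx (dx (R \<alpha>)) x t) + (\<sigma> \<alpha> - \<sigma> (\<alpha> - 1))"
      unfolding lhs_t lhs_x stress R_eq face_minus_face[OF \<open>1 \<le> \<alpha>\<close>] by linarith
  qed
  have S_exchange: "(\<Sum>\<alpha>=1..N. u \<alpha> x t * (uf \<alpha> * G \<alpha> - uf (\<alpha> - 1) * G (\<alpha> - 1))
        - (u \<alpha> x t)\<^sup>2 / 2 * (G \<alpha> - G (\<alpha> - 1)))
      = - (\<Sum>\<alpha>=1..N-1. \<bar>G \<alpha>\<bar> / 2 * (u (\<alpha> + 1) x t - u \<alpha> x t)\<^sup>2)"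
  proof -
    have "(\<Sum>\<alpha>=1..N. u \<alpha> x t * (uf \<alpha> * G \<alpha> - uf (\<alpha> - 1) * G (\<alpha> - 1)) - (u \<alpha> x t)\<^sup>2 / 2 * (G \<alpha> - G (\<alpha> - 1)))
        = (\<Sum>\<alpha>=1..N. (u \<alpha> x t * uf \<alpha> - (u \<alpha> x t)\<^sup>2 / 2) * G \<alpha>
            - (u \<alpha> x t * uf (\<alpha> - 1) - (u \<alpha> x t)\<^sup>2 / 2) * G (\<alpha> - 1))"
      by (intro sum.cong refl) (simp add: field_simps)
    also have "\<dots> = (\<Sum>\<alpha>=1..N-1. (u \<alpha> x t * uf \<alpha> - (u \<alpha> x t)\<^sup>2 / 2) * G \<alpha>
            - (u (\<alpha> + 1) x t * uf \<alpha> - (u (\<alpha> + 1) x t)\<^sup>2 / 2) * G \<alpha>)"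
      by (subst sum_diff_shift[OF N]) (simp add: G_ends)
    \<comment> \<open>The factor multiplying \<open>G \<alpha>\<close> is the jump
      \<open>u \<alpha> x t - u (\<alpha> + 1) x t\<close> times the deviation of
      \<open>uf \<alpha>\<close> from the mean of the two velocities. Upwinding makes this deviation
      half the jump, with a sign that makes the product with \<open>G \<alpha>\<close>
      nonpositive.\<close>
    also have "\<dots> = (\<Sum>\<alpha>=1..N-1. - (\<bar>G \<alpha>\<bar> / 2 * (u (\<alpha> + 1) x t - u \<alpha> x t)\<^sup>2))"
    proof (rule sum.cong[OF refl])
      fix \<alpha> assume "\<alpha> \<in> {1..N-1}"
      hence \<alpha>: "1 \<le> \<alpha>" "\<alpha> < N" by auto
      have f: "uf \<alpha> = (if G \<alpha> \<le> 0 then u \<alpha> x t else u (\<alpha> + 1) x t)"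
        using \<alpha> unfolding uf_def upwind_u_def G_def q_def ext_u_def by auto
      show "(u \<alpha> x t * uf \<alpha> - (u \<alpha> x t)\<^sup>2 / 2) * G \<alpha>
            - (u (\<alpha> + 1) x t * uf \<alpha> - (u (\<alpha> + 1) x t)\<^sup>2 / 2) * G \<alpha>
          = - (\<bar>G \<alpha>\<bar> / 2 * (u (\<alpha> + 1) x t - u \<alpha> x t)\<^sup>2)"
        unfolding f by (simp add: power2_eq_square field_simps)
    qed
    finally show ?thesis by (simp add: sum_negf)
  qed
  have S_sigma: "(\<Sum>\<alpha>=1..N. u \<alpha> x t * (\<sigma> \<alpha> - \<sigma> (\<alpha> - 1)))
      = - (\<Sum>\<alpha>=1..N. \<sigma> \<alpha> * (ext_u N u (\<alpha> + 1) x t - ext_u N u \<alpha> x t)) - u 1 x t * \<sigma> 0"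
  proof -
    \<comment> \<open>Since \<open>N\<close> is at least 1, the surface does not fall into the
      bottom case of \<open>closed_sigma\<close>. Summation by parts therefore leaves only the
      friction at the bottom as an end term.\<close>
    have "\<sigma> N = 0" using N by (simp add: \<sigma>_def closed_sigma_def)
    hence "(\<Sum>\<alpha>=1..N. u \<alpha> x t * \<sigma> \<alpha> - u \<alpha> x t * \<sigma> (\<alpha> - 1))
        = (\<Sum>\<alpha>=1..N-1. u \<alpha> x t * \<sigma> \<alpha> - u (\<alpha> + 1) x t * \<sigma> \<alpha>) - u 1 x t * \<sigma> 0"
      by (subst sum_diff_shift[OF N]) simp
    moreover have "(\<Sum>\<alpha>=1..N. \<sigma> \<alpha> * (ext_u N u (\<alpha> + 1) x t - ext_u N u \<alpha> x t))
        = (\<Sum>\<alpha>=1..N-1. - (u \<alpha> x t * \<sigma> \<alpha> - u (\<alpha> + 1) x t * \<sigma> \<alpha>))"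
    proof (rule sum.mono_neutral_cong_right)
      show "\<forall>\<alpha>\<in>{1..N} - {1..N-1}. \<sigma> \<alpha> * (ext_u N u (\<alpha> + 1) x t - ext_u N u \<alpha> x t) = 0"
      proof
        fix \<alpha> assume "\<alpha> \<in> {1..N} - {1..N-1}"
        hence "\<alpha> = N" by auto
        thus "\<sigma> \<alpha> * (ext_u N u (\<alpha> + 1) x t - ext_u N u \<alpha> x t) = 0" using \<open>\<sigma> N = 0\<close> by simp
      qed
    qed (auto simp: ext_u_def algebra_simps)
    ultimately show ?thesis by (simp add: sum_subtractf right_diff_distrib)
  qed
  have S_swap: "(\<Sum>\<alpha>=1..N. dx (q \<alpha>) x t * dx (R \<alpha>) x t - dx (T \<alpha>) x t * Q \<alpha>) = 0"
    using sum_upper_lower_swap[of "\<lambda>\<alpha>. dx (q \<alpha>) x t" "\<lambda>\<alpha>. dx (T \<alpha>) x t" N]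
    unfolding tR(2) Q_def sum_subtractf by simp
  \<comment> \<open>The potential energy rates telescope to \<open>g\<close> times the surface
    height times its time derivative, the bottom being fixed; total mass conservation equates this
    with minus the second sum.\<close>
  have S_gravity: "(\<Sum>\<alpha>=1..N. g * (face \<alpha> x t * face_t \<alpha> x t - face (\<alpha> - 1) x t * face_t (\<alpha> - 1) x t))
      + (\<Sum>\<alpha>=1..N. g * (zb x + H x t) * dx (q \<alpha>) x t) = 0"
  proof -
    have "(\<Sum>\<alpha>=1..N. face \<alpha> x t * face_t \<alpha> x t - face (\<alpha> - 1) x t * face_t (\<alpha> - 1) x t)
        = face N x t * face_t N x t"
      by (subst sum_diff_shift[OF N]) (simp add: face_t_def[of 0])
    moreover have "(\<Sum>\<alpha>=1..N. dx (q \<alpha>) x t) = - face_t N x t"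
      using G_eq[OF order_refl] G_ends by simp
    ultimately show ?thesis
      unfolding sum_distrib_left[symmetric] by (simp add: face_N)
  qed
  have friction: "u 1 x t * \<sigma> 0 = closed_kappa zb kappa H u x t / (c_face l zb H 0 x t) ^ 3 * (u 1 x t)\<^sup>2"
    unfolding \<sigma>_def closed_sigma_def by (simp add: power2_eq_square power3_eq_cube mult_ac)
  have source: "energy_source N l zb kappa H u w Sl Sf x t
      = - (\<Sum>\<alpha>=1..N. dx (u \<alpha>) x t * P \<alpha> x t + (dx (w \<alpha>) x t + dx (zm \<alpha>) x t * dx (u \<alpha>) x t) * T \<alpha> x t)
        - (\<Sum>\<alpha>=1..N. \<sigma> \<alpha> * (ext_u N u (\<alpha> + 1) x t - ext_u N u \<alpha> x t)) - u 1 x t * \<sigma> 0"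
    unfolding energy_source_def friction
    by (simp add: sum.distrib sum_subtractf P_def T_def \<sigma>_def algebra_simps)
  have "(\<Sum>\<alpha>=1..N. Kt \<alpha>) + (\<Sum>\<alpha>=1..N. \<Phi>x \<alpha>)
      + (\<Sum>\<alpha>=1..N. dx (u \<alpha>) x t * P \<alpha> x t + (dx (w \<alpha>) x t + dx (zm \<alpha>) x t * dx (u \<alpha>) x t) * T \<alpha> x t)
      - (\<Sum>\<alpha>=1..N. g * Cx \<alpha>)
    = (\<Sum>\<alpha>=1..N. u \<alpha> x t * (uf \<alpha> * G \<alpha> - uf (\<alpha> - 1) * G (\<alpha> - 1)) - (u \<alpha> x t)\<^sup>2 / 2 * (G \<alpha> - G (\<alpha> - 1)))
      + (\<Sum>\<alpha>=1..N. u \<alpha> x t * (\<sigma> \<alpha> - \<sigma> (\<alpha> - 1)))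
      - (\<Sum>\<alpha>=1..N. dx (q \<alpha>) x t * dx (R \<alpha>) x t - dx (T \<alpha>) x t * Q \<alpha>)
      + (\<Sum>\<alpha>=1..N. g * (zb x + H x t) * dx (q \<alpha>) x t)"
    unfolding sum.distrib[symmetric] sum_subtractf[symmetric] by (rule sum.cong[OF refl layer])
  thus ?thesis
    using S_gravity
    unfolding energy_dt flux_dx source correction S_exchange S_sigma S_swap by linarith
qed

end

text \<open>The derivation is split at the closure: the averages of a fluid solution obey the
  unclosed equations exactly, and substituting the closed expressions into those same equations
  yields the layer-averaged system. The last conjunct reconciles the two expressions given for the
  layer energy.\<close>

theorem proposition5p2:
  fixes N :: nat and l :: "nat \<Rightarrow> real" and g :: real and zb :: "real \<Rightarrow> real"
    and kappa :: "real \<times> real \<Rightarrow> real \<Rightarrow> real"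
    and I :: "real set" and H :: "real \<Rightarrow> real \<Rightarrow> real"
  assumes "1 \<le> N" and "\<And>j. j \<in> {1..N} \<Longrightarrow> 0 < l j" and "(\<Sum>j=1..N. l j) = 1"
    and "0 < g" and "\<And>v d. 0 \<le> kappa v d"
    and "open I" and "smooth_on UNIV zb"
    and "smooth_on (UNIV \<times> I) (\<lambda>(x, t). H x t)" and "\<And>x t. t \<in> I \<Longrightarrow> 0 < H x t"
  shows "(\<forall>u w p S.
            hydrostatic_NS g zb kappa I H u w p S \<longrightarrow>
            averaged_equations N l g zb kappa H I (exact_averages l zb H u w S))
       \<and> (\<forall>u w Sl Sf.
            (\<forall>\<alpha>\<in>{1..N}. smooth_on (UNIV \<times> I) (\<lambda>(x, t). u \<alpha> x t)) \<and>
            (\<forall>a b. \<forall>\<alpha>\<in>{1..N}. smooth_on (UNIV \<times> I) (\<lambda>(x, t). Sl a b \<alpha> x t)) \<longrightarrow>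
            (averaged_equations N l g zb kappa H I (closed_averages N l zb kappa H u w Sl Sf) \<longleftrightarrow>
             layer_averaged_system N l g zb kappa H I u w Sl Sf) \<and>
            (layer_averaged_system N l g zb kappa H I u w Sl Sf \<longrightarrow>
             (\<forall>x. \<forall>t\<in>I.
                dt (\<lambda>x t. \<Sum>\<alpha>=1..N. energy l g zb H u \<alpha> x t) x t
                  + dx (energy_flux N l g zb H u w Sl) x t
                = energy_source N l zb kappa H u w Sl Sf x t
                  + energy_correction N l g zb H u x t)))
       \<and> (\<forall>u x. \<forall>t\<in>I. \<forall>\<alpha>\<in>{1..N}.
            energy l g zb H u \<alpha> x t =
              layer_h l H \<alpha> x t * ((u \<alpha> x t)\<^sup>2 / 2 + g * z_mid l zb H \<alpha> x t))"
proof -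
  interpret layering N l zb I H
    by unfold_locales (use assms in auto)
  show ?thesis
  proof (intro conjI allI ballI impI)
    fix u w p S assume "hydrostatic_NS g zb kappa I H u w p S"
    thus "averaged_equations N l g zb kappa H I (exact_averages l zb H u w S)"
      by (rule exact_averaged_equations)
  next
    fix u w :: "nat \<Rightarrow> real \<Rightarrow> real \<Rightarrow> real" and Sl Sf :: "axis \<Rightarrow> axis \<Rightarrow> nat \<Rightarrow> real \<Rightarrow> real \<Rightarrow> real"
    assume "(\<forall>\<alpha>\<in>{1..N}. smooth_on (UNIV \<times> I) (\<lambda>(x, t). u \<alpha> x t)) \<and>
      (\<forall>a b. \<forall>\<alpha>\<in>{1..N}. smooth_on (UNIV \<times> I) (\<lambda>(x, t). Sl a b \<alpha> x t))"
    hence u: "\<And>\<alpha>. \<alpha> \<in> {1..N} \<Longrightarrow> smooth_on (UNIV \<times> I) (\<lambda>(x, t). u \<alpha> x t)"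
      and Sl: "\<And>a b \<alpha>. \<alpha> \<in> {1..N} \<Longrightarrow> smooth_on (UNIV \<times> I) (\<lambda>(x, t). Sl a b \<alpha> x t)"
      by blast+
    show "averaged_equations N l g zb kappa H I (closed_averages N l zb kappa H u w Sl Sf) \<longleftrightarrow>
        layer_averaged_system N l g zb kappa H I u w Sl Sf"
      by (rule closed_averaged_equations_iff[OF u])
    fix x t
    assume "layer_averaged_system N l g zb kappa H I u w Sl Sf" "t \<in> I"
    with u Sl show "dt (\<lambda>x t. \<Sum>\<alpha>=1..N. energy l g zb H u \<alpha> x t) x t + dx (energy_flux N l g zb H u w Sl) x t
        = energy_source N l zb kappa H u w Sl Sf x t + energy_correction N l g zb H u x t"
      by (rule energy_balance)
  next
    fix u :: "nat \<Rightarrow> real \<Rightarrow> real \<Rightarrow> real" and x t \<alpha>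
    assume "\<alpha> \<in> {1..N}"
    thus "energy l g zb H u \<alpha> x t = layer_h l H \<alpha> x t * ((u \<alpha> x t)\<^sup>2 / 2 + g * z_mid l zb H \<alpha> x t)"
      by (simp add: energy_eq)
  qed
qed

end
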